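(* (In $\mathsf{ZF}$.) For every infinite set $A$, if there is a finitary partition of $A$ without singleton blocks, then there is no surjection from $A$ onto $\mathscr{B}(A)$.
   Context: Work in $\mathsf{ZF}$ (no axiom of choice). A partition is finitary if all its blocks are finite; $\mathscr{B}(A)$ is the set of finitary partitions of $A$. *)

theory Defs
  imports Main
begin

text \<open>
  HOL itself contains a choice operator, so a statement about HOL sets would not be a statement
  of ZF. A theorem of ZF is rendered as a statement true in every model \<open>(U, \<epsilon>)\<close> of
  first-order ZF: \<open>U\<close> is an arbitrary type and \<open>\<epsilon>\<close> an arbitrary relation on it.
  The Separation and Replacement schemes are restricted to classes that are first-order definable
  with parameters. Allowing arbitrary HOL predicates there would give second-order ZF, whose models
  inherit the axiom of choice from HOL.

  All set-theoretic notions below quantify over elements of \<open>U\<close> only, so each of them is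
  (the interpretation of) a first-order formula in the language of set theory.
\<close>

text \<open>Formulas use de Bruijn indices: under \<open>Forall\<close>, index 0 is the bound variable.\<close>

datatype fm =
    Mem nat nat
  | Equal nat nat
  | Neg fm
  | Conj fm fm
  | Forall fm

locale set_structure =
  fixes mem :: "'u \<Rightarrow> 'u \<Rightarrow> bool"  (infix \<open>\<epsilon>\<close> 50)
begin

primrec sat :: "fm \<Rightarrow> (nat \<Rightarrow> 'u) \<Rightarrow> bool" where
  "sat (Mem i j) v \<longleftrightarrow> v i \<epsilon> v j"
| "sat (Equal i j) v \<longleftrightarrow> v i = v j"
| "sat (Neg p) v \<longleftrightarrow> \<not> sat p v"
| "sat (Conj p q) v \<longleftrightarrow> sat p v \<and> sat q v"
| "sat (Forall p) v \<longleftrightarrow> (\<forall>a. sat p (case_nat a v))"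

definition is_subset :: "'u \<Rightarrow> 'u \<Rightarrow> bool" where
  "is_subset x y \<longleftrightarrow> (\<forall>z. z \<epsilon> x \<longrightarrow> z \<epsilon> y)"

definition is_empty :: "'u \<Rightarrow> bool" where
  "is_empty x \<longleftrightarrow> (\<forall>z. \<not> z \<epsilon> x)"

text \<open>\<open>s = {x, y}\<close>\<close>

definition is_upair :: "'u \<Rightarrow> 'u \<Rightarrow> 'u \<Rightarrow> bool" where
  "is_upair s x y \<longleftrightarrow> (\<forall>z. z \<epsilon> s \<longleftrightarrow> z = x \<or> z = y)"

definition is_singleton :: "'u \<Rightarrow> bool" where
  "is_singleton s \<longleftrightarrow> (\<exists>x. is_upair s x x)"

text \<open>\<open>s = x \<union> {x}\<close>\<close>

definition is_succ :: "'u \<Rightarrow> 'u \<Rightarrow> bool" where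
  "is_succ s x \<longleftrightarrow> (\<forall>z. z \<epsilon> s \<longleftrightarrow> z \<epsilon> x \<or> z = x)"

definition is_inductive :: "'u \<Rightarrow> bool" where
  "is_inductive w \<longleftrightarrow>
     (\<exists>e. is_empty e \<and> e \<epsilon> w) \<and> (\<forall>x. x \<epsilon> w \<longrightarrow> (\<exists>s. is_succ s x \<and> s \<epsilon> w))"

text \<open>The natural numbers of the model, which may be non-standard.\<close>

definition is_natural :: "'u \<Rightarrow> bool" where
  "is_natural n \<longleftrightarrow> (\<forall>w. is_inductive w \<longrightarrow> n \<epsilon> w)"

text \<open>Kuratowski pair, \<open>p = {{x}, {x, y}}\<close>\<close>

definition is_pair :: "'u \<Rightarrow> 'u \<Rightarrow> 'u \<Rightarrow> bool" where
  "is_pair p x y \<longleftrightarrow> (\<exists>s t. is_upair s x x \<and> is_upair t x y \<and> is_upair p s t)"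

text \<open>\<open>(x, y) \<in> f\<close>\<close>

definition maps_to :: "'u \<Rightarrow> 'u \<Rightarrow> 'u \<Rightarrow> bool" where
  "maps_to f x y \<longleftrightarrow> (\<exists>p. is_pair p x y \<and> p \<epsilon> f)"

definition is_function :: "'u \<Rightarrow> 'u \<Rightarrow> 'u \<Rightarrow> bool" where
  "is_function f X Y \<longleftrightarrow>
     (\<forall>p. p \<epsilon> f \<longrightarrow> (\<exists>x y. x \<epsilon> X \<and> y \<epsilon> Y \<and> is_pair p x y)) \<and>
     (\<forall>x. x \<epsilon> X \<longrightarrow> (\<exists>!y. maps_to f x y))"

definition is_surjection :: "'u \<Rightarrow> 'u \<Rightarrow> 'u \<Rightarrow> bool" where
  "is_surjection f X Y \<longleftrightarrow>
     is_function f X Y \<and> (\<forall>y. y \<epsilon> Y \<longrightarrow> (\<exists>x. x \<epsilon> X \<and> maps_to f x y))"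

definition is_injection :: "'u \<Rightarrow> 'u \<Rightarrow> 'u \<Rightarrow> bool" where
  "is_injection f X Y \<longleftrightarrow>
     is_function f X Y \<and> (\<forall>x x' y. maps_to f x y \<and> maps_to f x' y \<longrightarrow> x = x')"

definition is_bijection :: "'u \<Rightarrow> 'u \<Rightarrow> 'u \<Rightarrow> bool" where
  "is_bijection f X Y \<longleftrightarrow> is_injection f X Y \<and> is_surjection f X Y"

definition is_finite :: "'u \<Rightarrow> bool" where
  "is_finite x \<longleftrightarrow> (\<exists>n f. is_natural n \<and> is_bijection f n x)"

definition is_infinite :: "'u \<Rightarrow> bool" where
  "is_infinite x \<longleftrightarrow> \<not> is_finite x"

definition is_partition :: "'u \<Rightarrow> 'u \<Rightarrow> bool" where
  "is_partition P A \<longleftrightarrow>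
     (\<forall>b. b \<epsilon> P \<longrightarrow> is_subset b A \<and> \<not> is_empty b) \<and>
     (\<forall>b c. b \<epsilon> P \<and> c \<epsilon> P \<and> b \<noteq> c \<longrightarrow> \<not> (\<exists>x. x \<epsilon> b \<and> x \<epsilon> c)) \<and>
     (\<forall>x. x \<epsilon> A \<longrightarrow> (\<exists>b. b \<epsilon> P \<and> x \<epsilon> b))"

definition is_finitary_partition :: "'u \<Rightarrow> 'u \<Rightarrow> bool" where
  "is_finitary_partition P A \<longleftrightarrow> is_partition P A \<and> (\<forall>b. b \<epsilon> P \<longrightarrow> is_finite b)"

text \<open>\<open>B = \<B>(A)\<close>\<close>

definition is_finitary_partitions :: "'u \<Rightarrow> 'u \<Rightarrow> bool" where
  "is_finitary_partitions B A \<longleftrightarrow> (\<forall>P. P \<epsilon> B \<longleftrightarrow> is_finitary_partition P A)"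

end

text \<open>
  In the two schemes the valuation \<open>v\<close> supplies the parameters. In Replacement, index 0 stands
  for the argument \<open>x\<close> and index 1 for the value \<open>y\<close>.
\<close>

locale ZF_model = set_structure mem
  for mem :: "'u \<Rightarrow> 'u \<Rightarrow> bool"  (infix \<open>\<epsilon>\<close> 50) +
  assumes extensionality: "\<forall>x y. (\<forall>z. z \<epsilon> x \<longleftrightarrow> z \<epsilon> y) \<longrightarrow> x = y"
    and foundation: "\<forall>x. \<not> is_empty x \<longrightarrow> (\<exists>y. y \<epsilon> x \<and> \<not> (\<exists>z. z \<epsilon> y \<and> z \<epsilon> x))"
    and pairing: "\<forall>x y. \<exists>s. is_upair s x y"
    and union: "\<forall>x. \<exists>u. \<forall>z. z \<epsilon> u \<longleftrightarrow> (\<exists>y. y \<epsilon> x \<and> z \<epsilon> y)"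
    and power_set: "\<forall>x. \<exists>p. \<forall>z. z \<epsilon> p \<longleftrightarrow> is_subset z x"
    and infinity: "\<exists>w. is_inductive w"
    and separation:
      "\<forall>\<phi> v A. \<exists>B. \<forall>x. x \<epsilon> B \<longleftrightarrow> x \<epsilon> A \<and> sat \<phi> (case_nat x v)"
    and replacement:
      "\<forall>\<phi> v A.
         (\<forall>x y y'. x \<epsilon> A \<and> sat \<phi> (case_nat x (case_nat y v)) \<and>
                   sat \<phi> (case_nat x (case_nat y' v)) \<longrightarrow> y = y') \<longrightarrow>
         (\<exists>B. \<forall>y. y \<epsilon> B \<longleftrightarrow> (\<exists>x. x \<epsilon> A \<and> sat \<phi> (case_nat x (case_nat y v))))"

end

theory Submission
  imports Defs
begin

text \<open>
  Let \<open>P\<close> be a finitary partition of \<open>A\<close> without singleton blocks, \<open>A\<close> infinite. Completing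
  \<open>S \<subseteq> P\<close> by singletons embeds the power set of \<open>P\<close> into \<open>\<B>(A)\<close>, so a surjection from \<open>A\<close> onto
  \<open>\<B>(A)\<close> would let every block \<open>x \<in> P\<close> cover finitely many subsets of \<open>P\<close> such that all subsets are
  covered. To refute this, let \<open>W\<close> be a well-ordered set of subsets of \<open>X = P\<close>. Ordering \<open>X\<close> first by a
  bound on the finite cardinalities of the covered sets, then lexicographically (largest element first)
  by the finite set of covered members of \<open>W\<close>, gives a canonical prewellordering of \<open>X\<close> without last
  class. Each of its classes covers finitely many members of \<open>W\<close>. Splitting the classes into blocks of
  type \<open>\<omega>\<close> and matching, inside each block, the \<open>k\<close>-th member of \<open>W\<close> that appears there with the
  \<open>k\<close>-th class defines, without choice, a map from a set of classes onto \<open>W\<close>, and diagonalization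
  along it a subset of \<open>X\<close> outside \<open>W\<close>. Iterating this, as in Zermelo's proof of the well-ordering
  theorem, is contradictory.
\<close>

section \<open>Definability with parameters\<close>

text \<open>A point of \<open>X\<close> covers an unordered finite set, so Cantor's argument has no
  function to diagonalize along. Turning the cover into a function on classes is a counting problem:
  a class may cover several members of the family, and a block with only finitely many classes could
  have too few positions for them. A block of type omega absorbs any finite number per class, which
  is why a last class has to be excluded. The lexicographic order alone may have one: for the empty
  family all points are tied. The bound on cardinalities does not depend on the family, and it grows
  without end because an infinite set has finite subsets of every size, each of them covered.
  Matching by position needs no choice, since positions are natural numbers of the model. These may
  be nonstandard, and HOL has choice, so HOL's own finiteness and induction say nothing about the
  model: every comprehension is over a definable class, and every induction proves a definable
  property.\<close>

primrec rename :: "(nat \<Rightarrow> nat) \<Rightarrow> fm \<Rightarrow> fm" where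
  "rename f (Mem i j) = Mem (f i) (f j)"
| "rename f (Equal i j) = Equal (f i) (f j)"
| "rename f (Neg p) = Neg (rename f p)"
| "rename f (Conj p q) = Conj (rename f p) (rename f q)"
| "rename f (Forall p) = Forall (rename (case_nat 0 (Suc \<circ> f)) p)"

definition shift :: "(nat \<Rightarrow> 'u) \<Rightarrow> nat \<Rightarrow> 'u" where
  "shift v n = v (Suc n)"

definition merge :: "(nat \<Rightarrow> 'u) \<Rightarrow> (nat \<Rightarrow> 'u) \<Rightarrow> nat \<Rightarrow> 'u" where
  "merge v e n = (if even n then v (n div 2) else e (n div 2))"

context set_structure
begin

lemma sat_rename: "sat (rename f p) v \<longleftrightarrow> sat p (\<lambda>n. v (f n))"
proof (induction p arbitrary: f v)
  case (Forall p)
  have "(\<lambda>n. case_nat a v (case_nat 0 (Suc \<circ> f) n)) = case_nat a (\<lambda>n. v (f n))" for a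
    by (auto split: nat.split)
  with Forall show ?case by simp
qed auto

text \<open>The parameters \<open>e\<close> occupy the odd indices, so that quantifiers need to shift \<open>v\<close> only.\<close>

definition definable :: "((nat \<Rightarrow> 'u) \<Rightarrow> bool) \<Rightarrow> bool" where
  "definable P \<longleftrightarrow> (\<exists>p e. \<forall>v. P v \<longleftrightarrow> sat p (merge v e))"

text \<open>Formulas have no function symbols, so an operation is definable through its graph: the
  value sits at index 0 and the variables of the term move up by one.\<close>

definition definable_term :: "((nat \<Rightarrow> 'u) \<Rightarrow> 'u) \<Rightarrow> bool" where
  "definable_term f \<longleftrightarrow> definable (\<lambda>v. v 0 = f (shift v))"

text \<open>Only the even indices, those of \<open>v\<close>, are renamed; the parameters at the odd
  indices stay where they are.\<close>

lemma definable_rename: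
  assumes "definable P"
  shows "definable (\<lambda>v. P (\<lambda>n. v (g n)))"
proof -
  from assms obtain p e where p: "\<And>v. P v \<longleftrightarrow> sat p (merge v e)"
    by (auto simp: definable_def)
  have "(\<lambda>n. merge v e (if even n then 2 * g (n div 2) else n)) = merge (\<lambda>n. v (g n)) e" for v
    by (auto simp: merge_def)
  then have "P (\<lambda>n. v (g n)) \<longleftrightarrow> sat (rename (\<lambda>n. if even n then 2 * g (n div 2) else n) p) (merge v e)" for v
    by (simp add: p sat_rename)
  then show ?thesis
    unfolding definable_def by blast
qed

lemma definable_const: "definable (\<lambda>v. b)"
  unfolding definable_def
  by (rule exI[of _ "if b then Equal 0 0 else Neg (Equal 0 0)"]) simp

lemma definable_not:
  assumes "definable P"
  shows "definable (\<lambda>v. \<not> P v)"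
  using assms unfolding definable_def by (metis sat.simps(3))

lemma definable_conj:
  assumes "definable P" "definable Q"
  shows "definable (\<lambda>v. P v \<and> Q v)"
proof -
  from assms obtain p e q d where p: "\<And>v. P v \<longleftrightarrow> sat p (merge v e)"
    and q: "\<And>v. Q v \<longleftrightarrow> sat q (merge v d)"
    by (auto simp: definable_def)
  \<comment> \<open>The two formulas have separate parameters, which are interleaved.
    \<open>e k\<close> moves from \<open>n = 2 * k + 1\<close> to
    \<open>4 * k + 1 = 2 * n - 1\<close>, and \<open>d k\<close> from the same \<open>n\<close> to
    \<open>4 * k + 3 = 2 * n + 1\<close>.\<close>
  have "merge v (merge e d) (if even n then n else 2 * n - 1) = merge v e n" for v n
  proof (cases "even n")
    case False
    then obtain k where "n = 2 * k + 1" by (rule oddE)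
    then show ?thesis by (simp add: merge_def)
  qed (simp add: merge_def)
  moreover have "merge v (merge e d) (if even n then n else 2 * n + 1) = merge v d n" for v n
  proof (cases "even n")
    case False
    then obtain k where "n = 2 * k + 1" by (rule oddE)
    then show ?thesis by (simp add: merge_def)
  qed (simp add: merge_def)
  ultimately have "P v \<and> Q v \<longleftrightarrow>
    sat (Conj (rename (\<lambda>n. if even n then n else 2 * n - 1) p)
      (rename (\<lambda>n. if even n then n else 2 * n + 1) q)) (merge v (merge e d))" for v
    by (simp add: p q sat_rename)
  then show ?thesis
    unfolding definable_def by blast
qed

lemma definable_all:
  assumes "definable (\<lambda>v. P (v 0) (shift v))"
  shows "definable (\<lambda>v. \<forall>x. P x v)"
proof -
  from assms obtain p e where p: "\<And>v. P (v 0) (shift v) \<longleftrightarrow> sat p (merge v e)"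
    by (auto simp: definable_def)
  \<comment> \<open>Binding a variable exchanges parities: in \<open>case_nat x (merge v e)\<close>
    the value \<open>v k\<close> stands at \<open>2 * k + 1\<close> and \<open>e k\<close> at
    \<open>2 * k + 2\<close>, whereas \<open>merge (case_nat x v) e\<close> has them the other way
    round. \<open>f\<close> swaps them back, and truncated subtraction keeps the bound variable at
    0.\<close>
  define f where "f n = (if even n then n - 1 else n + 1)" for n :: nat
  have "case_nat x (merge v e) (f n) = merge (case_nat x v) e n" for x v n
  proof (cases "even n")
    case True
    then obtain k where "n = 2 * k" by blast
    then show ?thesis by (cases k) (simp_all add: merge_def f_def)
  next
    case False
    then show ?thesis by (simp add: merge_def f_def)
  qed
  moreover have "P x v \<longleftrightarrow> sat p (merge (case_nat x v) e)" for x v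
    using p[of "case_nat x v"] by (simp add: shift_def[abs_def])
  ultimately have "(\<forall>x. P x v) \<longleftrightarrow> sat (Forall (rename f p)) (merge v e)" for v
    by (simp add: sat_rename)
  then show ?thesis
    unfolding definable_def by blast
qed

lemma definable_ex:
  assumes "definable (\<lambda>v. P (v 0) (shift v))"
  shows "definable (\<lambda>v. \<exists>x. P x v)"
proof -
  have "definable (\<lambda>v. \<not> (\<forall>x. \<not> P x v))"
    by (rule definable_not, rule definable_all, rule definable_not, rule assms)
  then show ?thesis by simp
qed

lemma definable_disj:
  assumes "definable P" "definable Q"
  shows "definable (\<lambda>v. P v \<or> Q v)"
proof -
  have "definable (\<lambda>v. \<not> (\<not> P v \<and> \<not> Q v))"
    by (intro definable_not definable_conj assms)
  then show ?thesis by simp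
qed

lemma definable_imp:
  assumes "definable P" "definable Q"
  shows "definable (\<lambda>v. P v \<longrightarrow> Q v)"
  unfolding imp_conv_disj by (intro definable_disj definable_not assms)

lemma definable_iff:
  assumes "definable P" "definable Q"
  shows "definable (\<lambda>v. P v \<longleftrightarrow> Q v)"
  unfolding iff_conv_conj_imp by (intro definable_conj definable_imp assms)

lemma definable_eq_var: "definable (\<lambda>v. v i = v j)"
  unfolding definable_def
  by (rule exI[of _ "Equal (2 * i) (2 * j)"]) (simp add: merge_def)

lemma definable_mem_var: "definable (\<lambda>v. v i \<epsilon> v j)"
  unfolding definable_def
  by (rule exI[of _ "Mem (2 * i) (2 * j)"]) (simp add: merge_def)

lemma definable_term_const: "definable_term (\<lambda>v. c)"
  unfolding definable_term_def definable_def
  by (rule exI[of _ "Equal 0 1"], rule exI[of _ "\<lambda>_. c"]) (simp add: merge_def)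

lemma definable_term_var: "definable_term (\<lambda>v. v 0)"
  unfolding definable_term_def shift_def by (rule definable_eq_var)

lemma definable_term_shift:
  assumes "definable_term f"
  shows "definable_term (\<lambda>v. f (shift v))"
proof -
  have "shift (\<lambda>n. v (if n = 0 then 0 else Suc n)) = shift (shift v)" for v :: "nat \<Rightarrow> 'u"
    by (auto simp: shift_def)
  then show ?thesis
    using definable_rename[OF assms[unfolded definable_term_def],
        of "\<lambda>n. if n = 0 then 0 else Suc n"]
    by (simp add: definable_term_def)
qed

lemma definable_term_var1: "definable_term (\<lambda>v. v 1)"
  using definable_term_shift[OF definable_term_var] by (simp add: shift_def)

lemma definable_subst:
  assumes "definable_term f" "definable (\<lambda>v. P (v 0) (shift v))"
  shows "definable (\<lambda>v. P (f v) v)"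
  using definable_ex[where P = "\<lambda>x v. x = f v \<and> P x v",
      OF definable_conj[OF assms(1)[unfolded definable_term_def] assms(2)]]
  by simp

text \<open>For a relation known only to be definable in two variables: it may then be applied to
  arbitrary definable terms, also below quantifiers.\<close>

lemma definable_subst2:
  assumes "definable (\<lambda>v. R (v 0) (v 1))" "definable_term f" "definable_term g"
  shows "definable (\<lambda>v. R (f v) (g v))"
proof (rule definable_subst[OF assms(2)], rule definable_subst[where P = "\<lambda>y v. R (v 0) y"])
  show "definable_term (\<lambda>v. g (shift v))"
    by (rule definable_term_shift[OF assms(3)])
  show "definable (\<lambda>v. R (shift v 0) (v 0))"
    using definable_rename[OF assms(1), of "\<lambda>n. if n = 0 then 1 else 0"]
    by (simp add: shift_def)
qed

lemma definable_eq:
  assumes "definable_term f" "definable_term g"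
  shows "definable (\<lambda>v. f v = g v)"
  by (rule definable_subst[OF assms(1)])
    (use assms(2) in \<open>simp add: definable_term_def\<close>)

lemma definable_mem:
  assumes "definable_term f" "definable_term g"
  shows "definable (\<lambda>v. f v \<epsilon> g v)"
proof (rule definable_subst[OF assms(1)], rule definable_subst[where P = "\<lambda>y v. v 0 \<epsilon> y"])
  show "definable_term (\<lambda>v. g (shift v))"
    by (rule definable_term_shift[OF assms(2)])
  show "definable (\<lambda>v. shift v 0 \<epsilon> v 0)"
    unfolding shift_def by (rule definable_mem_var)
qed

text \<open>Constants come first and shifting last, since shifting applies to constants indefinitely.\<close>

lemmas definable_rules =
  definable_term_const definable_term_var definable_const definable_not definable_conj definable_disj
  definable_imp definable_iff definable_all definable_ex definable_eq definable_mem

named_theorems definable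

lemmas [definable] = definable_rules

lemma definable_is_subset [definable]:
  "definable_term f \<Longrightarrow> definable_term g \<Longrightarrow> definable (\<lambda>v. is_subset (f v) (g v))"
  unfolding is_subset_def by (assumption | rule definable definable_term_shift)+

lemma definable_is_empty [definable]:
  "definable_term f \<Longrightarrow> definable (\<lambda>v. is_empty (f v))"
  unfolding is_empty_def by (assumption | rule definable definable_term_shift)+

lemma definable_is_upair [definable]:
  "definable_term f \<Longrightarrow> definable_term g \<Longrightarrow> definable_term h \<Longrightarrow>
    definable (\<lambda>v. is_upair (f v) (g v) (h v))"
  unfolding is_upair_def by (assumption | rule definable definable_term_shift)+

lemma definable_is_succ [definable]:
  "definable_term f \<Longrightarrow> definable_term g \<Longrightarrow> definable (\<lambda>v. is_succ (f v) (g v))"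
  unfolding is_succ_def by (assumption | rule definable definable_term_shift)+

lemma definable_is_inductive [definable]:
  "definable_term f \<Longrightarrow> definable (\<lambda>v. is_inductive (f v))"
  unfolding is_inductive_def by (assumption | rule definable definable_term_shift)+

lemma definable_is_natural [definable]:
  "definable_term f \<Longrightarrow> definable (\<lambda>v. is_natural (f v))"
  unfolding is_natural_def by (assumption | rule definable definable_term_shift)+

lemma definable_is_pair [definable]:
  "definable_term f \<Longrightarrow> definable_term g \<Longrightarrow> definable_term h \<Longrightarrow>
    definable (\<lambda>v. is_pair (f v) (g v) (h v))"
  unfolding is_pair_def by (assumption | rule definable definable_term_shift)+

lemma definable_maps_to [definable]:
  "definable_term f \<Longrightarrow> definable_term g \<Longrightarrow> definable_term h \<Longrightarrow>
    definable (\<lambda>v. maps_to (f v) (g v) (h v))"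
  unfolding maps_to_def by (assumption | rule definable definable_term_shift)+

lemma definable_is_function [definable]:
  "definable_term f \<Longrightarrow> definable_term g \<Longrightarrow> definable_term h \<Longrightarrow>
    definable (\<lambda>v. is_function (f v) (g v) (h v))"
  unfolding is_function_def Ex1_def by (assumption | rule definable definable_term_shift)+

lemma definable_is_bijection [definable]:
  "definable_term f \<Longrightarrow> definable_term g \<Longrightarrow> definable_term h \<Longrightarrow>
    definable (\<lambda>v. is_bijection (f v) (g v) (h v))"
  unfolding is_bijection_def is_injection_def is_surjection_def
  by (assumption | rule definable definable_term_shift)+

lemma definable_is_finite [definable]:
  "definable_term f \<Longrightarrow> definable (\<lambda>v. is_finite (f v))"
  unfolding is_finite_def by (assumption | rule definable definable_term_shift)+

lemma definable_is_finitary_partition [definable]: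
  "definable_term f \<Longrightarrow> definable_term g \<Longrightarrow> definable (\<lambda>v. is_finitary_partition (f v) (g v))"
  unfolding is_finitary_partition_def is_partition_def
  by (assumption | rule definable definable_term_shift)+

end

section \<open>Sets in a model of ZF\<close>

context ZF_model
begin

lemma set_eqI: "(\<And>z. z \<epsilon> x \<longleftrightarrow> z \<epsilon> y) \<Longrightarrow> x = y"
  using extensionality by blast

lemma subsetI: "(\<And>z. z \<epsilon> x \<Longrightarrow> z \<epsilon> y) \<Longrightarrow> is_subset x y"
  by (simp add: is_subset_def)

lemma subset_antisym: "is_subset x y \<Longrightarrow> is_subset y x \<Longrightarrow> x = y"
  by (rule set_eqI) (auto simp: is_subset_def)

text \<open>When the class \<open>P\<close> is not a set, \<open>collect P\<close> must not depend on \<open>P\<close>, as otherwise it might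
  not be definable.\<close>

definition collect :: "('u \<Rightarrow> bool) \<Rightarrow> 'u" where
  "collect P = (if \<exists>s. \<forall>x. x \<epsilon> s \<longleftrightarrow> P x then THE s. \<forall>x. x \<epsilon> s \<longleftrightarrow> P x else undefined)"

lemma collect_eqI:
  assumes "\<And>x. x \<epsilon> s \<longleftrightarrow> P x"
  shows "collect P = s"
proof -
  have "(THE s. \<forall>x. x \<epsilon> s \<longleftrightarrow> P x) = s"
    by (rule the_equality) (auto simp: assms intro: set_eqI)
  then show ?thesis
    using assms unfolding collect_def by auto
qed

lemma mem_collect:
  assumes "\<exists>s. \<forall>x. x \<epsilon> s \<longleftrightarrow> P x"
  shows "x \<epsilon> collect P \<longleftrightarrow> P x"
  using assms collect_eqI by blast

lemma definable_collect [definable]: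
  assumes "definable (\<lambda>v. P (v 0) (shift v))"
  shows "definable_term (\<lambda>v. collect (\<lambda>x. P x v))"
proof -
  \<comment> \<open>The second disjunct is first-order because the default value is one fixed
    element, which can serve as a parameter.\<close>
  have eq: "y = collect Q \<longleftrightarrow> (\<forall>x. x \<epsilon> y \<longleftrightarrow> Q x) \<or>
    \<not> (\<exists>s. \<forall>x. x \<epsilon> s \<longleftrightarrow> Q x) \<and> y = undefined" for y Q
  proof (cases "\<exists>s. \<forall>x. x \<epsilon> s \<longleftrightarrow> Q x")
    case True
    then show ?thesis
      using collect_eqI[of y Q] mem_collect[OF True] by auto
  next
    case False
    then have "collect Q = undefined"
      unfolding collect_def by (rule if_not_P)
    moreover have "\<not> (\<forall>x. x \<epsilon> y \<longleftrightarrow> Q x)"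
      using False by blast
    ultimately show ?thesis
      using False by argo
  qed
  have skip: "shift (\<lambda>n. v (if n = 0 then 0 else Suc n)) = shift (shift v)" for v :: "nat \<Rightarrow> 'u"
    by (auto simp: shift_def)
  \<comment> \<open>\<open>P\<close> is arbitrary, so the rules cannot descend into it. Its formula
    is moved explicitly to the two depths at which it occurs in \<open>eq\<close>: below one further
    quantifier here, below two in \<open>P'\<close>.\<close>
  have P: "definable (\<lambda>v. P (v 0) (shift (shift v)))"
    using definable_rename[OF assms, of "\<lambda>n. if n = 0 then 0 else Suc n"] skip by simp
  have P': "definable (\<lambda>v. P (v 0) (shift (shift (shift v))))"
    using definable_rename[OF P, of "\<lambda>n. if n = 0 then 0 else Suc n"] skip by simp
  show ?thesis
    unfolding definable_term_def eq
    by (rule P P' definable definable_term_shift)+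
qed

lemma separation':
  assumes "definable (\<lambda>v. P (v 0))"
  shows "\<exists>s. \<forall>x. x \<epsilon> s \<longleftrightarrow> x \<epsilon> a \<and> P x"
proof -
  from assms obtain p e where p: "\<And>v. P (v 0) \<longleftrightarrow> sat p (merge v e)"
    by (auto simp: definable_def)
  \<comment> \<open>\<open>P\<close> reads only \<open>v 0\<close>, so every even index may be
    interpreted by \<open>x\<close>; index 0 then holds \<open>x\<close>, and the parameters follow
    in order.\<close>
  have "(\<lambda>n. case_nat x e (if even n then 0 else Suc (n div 2))) = merge (\<lambda>_. x) e" for x
    by (auto simp: merge_def)
  then have "P x \<longleftrightarrow> sat (rename (\<lambda>n. if even n then 0 else Suc (n div 2)) p) (case_nat x e)" for x
    using p[of "\<lambda>_. x"] by (simp add: sat_rename)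
  then show ?thesis
    using separation by simp
qed

text \<open>The standard way to justify a comprehension below: an upper bound and a definability
  proof replace any appeal to full HOL comprehension.\<close>

lemma mem_collect_bounded:
  assumes "\<And>x. P x \<Longrightarrow> x \<epsilon> a" "definable (\<lambda>v. P (v 0))"
  shows "x \<epsilon> collect P \<longleftrightarrow> P x"
proof (rule mem_collect)
  show "\<exists>s. \<forall>x. x \<epsilon> s \<longleftrightarrow> P x"
    using separation'[OF assms(2), of a] assms(1) by metis
qed

definition emp :: 'u where "emp = collect (\<lambda>_. False)"
definition upair :: "'u \<Rightarrow> 'u \<Rightarrow> 'u" where "upair x y = collect (\<lambda>z. z = x \<or> z = y)"
definition union_of :: "'u \<Rightarrow> 'u" where "union_of a = collect (\<lambda>z. \<exists>y. y \<epsilon> a \<and> z \<epsilon> y)"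
definition pow :: "'u \<Rightarrow> 'u" where "pow a = collect (\<lambda>z. is_subset z a)"
definition insert_in :: "'u \<Rightarrow> 'u \<Rightarrow> 'u" where "insert_in x s = collect (\<lambda>z. z = x \<or> z \<epsilon> s)"
definition remove :: "'u \<Rightarrow> 'u \<Rightarrow> 'u" where "remove x s = collect (\<lambda>z. z \<noteq> x \<and> z \<epsilon> s)"
definition union2 :: "'u \<Rightarrow> 'u \<Rightarrow> 'u" where "union2 a b = collect (\<lambda>z. z \<epsilon> a \<or> z \<epsilon> b)"

lemma definable_upair [definable]:
  "definable_term f \<Longrightarrow> definable_term g \<Longrightarrow> definable_term (\<lambda>v. upair (f v) (g v))"
  unfolding upair_def by (assumption | rule definable definable_term_shift)+

lemma definable_union_of [definable]:
  "definable_term f \<Longrightarrow> definable_term (\<lambda>v. union_of (f v))"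
  unfolding union_of_def by (assumption | rule definable definable_term_shift)+

lemma definable_pow [definable]:
  "definable_term f \<Longrightarrow> definable_term (\<lambda>v. pow (f v))"
  unfolding pow_def by (assumption | rule definable definable_term_shift)+

lemma definable_insert_in [definable]:
  "definable_term f \<Longrightarrow> definable_term g \<Longrightarrow> definable_term (\<lambda>v. insert_in (f v) (g v))"
  unfolding insert_in_def by (assumption | rule definable definable_term_shift)+

lemma definable_remove [definable]:
  "definable_term f \<Longrightarrow> definable_term g \<Longrightarrow> definable_term (\<lambda>v. remove (f v) (g v))"
  unfolding remove_def by (assumption | rule definable definable_term_shift)+

lemma definable_union2 [definable]:
  "definable_term f \<Longrightarrow> definable_term g \<Longrightarrow> definable_term (\<lambda>v. union2 (f v) (g v))"
  unfolding union2_def by (assumption | rule definable definable_term_shift)+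

lemma mem_upair [simp]: "z \<epsilon> upair x y \<longleftrightarrow> z = x \<or> z = y"
  unfolding upair_def by (rule mem_collect) (use pairing in \<open>simp add: is_upair_def\<close>)

lemma mem_union_of [simp]: "z \<epsilon> union_of a \<longleftrightarrow> (\<exists>y. y \<epsilon> a \<and> z \<epsilon> y)"
  unfolding union_of_def by (rule mem_collect) (use union in blast)

lemma mem_pow [simp]: "z \<epsilon> pow a \<longleftrightarrow> is_subset z a"
  unfolding pow_def by (rule mem_collect) (use power_set in blast)

lemma not_mem_emp [simp]: "\<not> z \<epsilon> emp"
proof -
  have "z \<epsilon> emp \<longleftrightarrow> False"
    unfolding emp_def by (rule mem_collect_bounded) (simp | rule definable definable_term_shift)+
  then show ?thesis by simp
qed

lemma mem_union2 [simp]: "z \<epsilon> union2 a b \<longleftrightarrow> z \<epsilon> a \<or> z \<epsilon> b"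
  unfolding union2_def
  by (rule mem_collect) (rule exI[of _ "union_of (upair a b)"], auto)

lemma mem_insert_in [simp]: "z \<epsilon> insert_in x s \<longleftrightarrow> z = x \<or> z \<epsilon> s"
  unfolding insert_in_def
  by (rule mem_collect) (rule exI[of _ "union2 (upair x x) s"], auto)

lemma mem_remove [simp]: "z \<epsilon> remove x s \<longleftrightarrow> z \<noteq> x \<and> z \<epsilon> s"
  unfolding remove_def
  by (rule mem_collect_bounded[where a = s]) (simp | rule definable definable_term_shift)+

lemma is_empty_iff: "is_empty x \<longleftrightarrow> x = emp"
  by (auto simp: is_empty_def intro: set_eqI)

lemma is_upair_iff: "is_upair s x y \<longleftrightarrow> s = upair x y"
  by (auto simp: is_upair_def intro: set_eqI)

lemma is_succ_iff: "is_succ s x \<longleftrightarrow> s = insert_in x x"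
  by (auto simp: is_succ_def intro: set_eqI)

lemma insert_remove: "x \<epsilon> s \<Longrightarrow> insert_in x (remove x s) = s"
  by (rule set_eqI) auto

lemma remove_insert: "\<not> x \<epsilon> s \<Longrightarrow> remove x (insert_in x s) = s"
  by (rule set_eqI) auto

section \<open>Ordered pairs and bijections\<close>

definition kpair :: "'u \<Rightarrow> 'u \<Rightarrow> 'u" where
  "kpair x y = upair (upair x x) (upair x y)"

lemma definable_kpair [definable]:
  "definable_term f \<Longrightarrow> definable_term g \<Longrightarrow> definable_term (\<lambda>v. kpair (f v) (g v))"
  unfolding kpair_def by (assumption | rule definable definable_term_shift)+

lemma is_pair_iff: "is_pair p x y \<longleftrightarrow> p = kpair x y"
  by (simp add: is_pair_def is_upair_iff kpair_def)

lemma upair_eq_iff: "upair x y = upair z w \<longleftrightarrow> x = z \<and> y = w \<or> x = w \<and> y = z"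
proof
  assume eq: "upair x y = upair z w"
  have "t = x \<or> t = y \<longleftrightarrow> t = z \<or> t = w" for t
    using mem_upair[of t x y] mem_upair[of t z w] by (simp add: eq)
  then show "x = z \<and> y = w \<or> x = w \<and> y = z" by metis
qed (auto intro: set_eqI)

lemma kpair_eq_iff [simp]: "kpair x y = kpair z w \<longleftrightarrow> x = z \<and> y = w"
  by (auto simp: kpair_def upair_eq_iff)

lemma maps_to_iff: "maps_to f x y \<longleftrightarrow> kpair x y \<epsilon> f"
  by (simp add: maps_to_def is_pair_iff)

text \<open>A bijection has to be an element of the model. Pairs of elements of \<open>a\<close> and
  \<open>b\<close> lie in the double power set of their union, so separation turns a definable
  relation into one.\<close>

lemma bijectionI:
  assumes "definable (\<lambda>v. R (v 0) (v 1))"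
    and "\<And>x. x \<epsilon> a \<Longrightarrow> \<exists>y. y \<epsilon> b \<and> R x y"
    and "\<And>y. y \<epsilon> b \<Longrightarrow> \<exists>x. x \<epsilon> a \<and> R x y"
    and "\<And>x y y'. x \<epsilon> a \<Longrightarrow> y \<epsilon> b \<Longrightarrow> y' \<epsilon> b \<Longrightarrow> R x y \<Longrightarrow> R x y' \<Longrightarrow> y = y'"
    and "\<And>x x' y. x \<epsilon> a \<Longrightarrow> x' \<epsilon> a \<Longrightarrow> y \<epsilon> b \<Longrightarrow> R x y \<Longrightarrow> R x' y \<Longrightarrow> x = x'"
  shows "\<exists>f. is_bijection f a b"
proof -
  let ?f = "collect (\<lambda>p. \<exists>x y. x \<epsilon> a \<and> y \<epsilon> b \<and> R x y \<and> p = kpair x y)"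
  have "p \<epsilon> ?f \<longleftrightarrow> (\<exists>x y. x \<epsilon> a \<and> y \<epsilon> b \<and> R x y \<and> p = kpair x y)" for p
  proof (rule mem_collect_bounded[where a = "pow (pow (union2 a b))"])
    show "definable (\<lambda>v. \<exists>x y. x \<epsilon> a \<and> y \<epsilon> b \<and> R x y \<and> v 0 = kpair x y)"
      by (rule definable_subst2[OF assms(1)] definable definable_term_shift)+
  qed (auto simp: kpair_def is_subset_def)
  then have "is_bijection ?f a b"
    unfolding is_bijection_def is_injection_def is_surjection_def is_function_def
      maps_to_iff is_pair_iff
    using assms(2-5) by (auto; metis)
  then show ?thesis ..
qed

section \<open>Natural numbers and finite sets\<close>

lemma not_mem_self: "\<not> x \<epsilon> x"
proof -
  have "\<not> is_empty (upair x x)"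
    by (auto simp: is_empty_def)
  then obtain y where "y \<epsilon> upair x x" "\<not> (\<exists>z. z \<epsilon> y \<and> z \<epsilon> upair x x)"
    using foundation by blast
  then show ?thesis by auto
qed

lemma not_mem_sym: "x \<epsilon> y \<Longrightarrow> \<not> y \<epsilon> x"
proof -
  have "\<not> is_empty (upair x y)"
    by (auto simp: is_empty_def)
  then obtain z where "z \<epsilon> upair x y" "\<not> (\<exists>w. w \<epsilon> z \<and> w \<epsilon> upair x y)"
    using foundation by blast
  then show "x \<epsilon> y \<Longrightarrow> \<not> y \<epsilon> x" by auto
qed

definition omega :: 'u where "omega = collect is_natural"

lemma definable_omega [definable]: "definable_term (\<lambda>v. omega)"
  by (rule definable)

lemma mem_omega: "n \<epsilon> omega \<longleftrightarrow> is_natural n"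
proof -
  obtain w where "is_inductive w" using infinity by blast
  then show ?thesis
    unfolding omega_def
    by (intro mem_collect_bounded[where a = w])
      (auto simp: is_natural_def[abs_def] intro!: definable_is_natural[unfolded is_natural_def] definable_term_var)
qed

lemma inductive_iff:
  "is_inductive w \<longleftrightarrow> emp \<epsilon> w \<and> (\<forall>x. x \<epsilon> w \<longrightarrow> insert_in x x \<epsilon> w)"
  by (simp add: is_inductive_def is_empty_iff is_succ_iff)

lemma natural_zero: "is_natural emp"
  by (simp add: is_natural_def inductive_iff)

lemma natural_succ: "is_natural n \<Longrightarrow> is_natural (insert_in n n)"
  by (simp add: is_natural_def inductive_iff)

text \<open>Naturals of the model may be nonstandard, so induction is available only for definable
  \<open>P\<close>: the naturals satisfying \<open>P\<close> must form a set, which is then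
  inductive.\<close>

lemma natural_induct [consumes 1, case_names definable zero succ]:
  assumes "is_natural n" "definable (\<lambda>v. P (v 0))"
    and "P emp" "\<And>n. is_natural n \<Longrightarrow> P n \<Longrightarrow> P (insert_in n n)"
  shows "P n"
proof -
  let ?w = "collect (\<lambda>n. is_natural n \<and> P n)"
  have w: "x \<epsilon> ?w \<longleftrightarrow> is_natural x \<and> P x" for x
    by (rule mem_collect_bounded[where a = omega])
      (simp add: mem_omega | rule assms definable definable_term_shift)+
  have "is_inductive ?w"
    using assms natural_zero natural_succ by (simp add: inductive_iff w)
  then show ?thesis
    using assms(1) w is_natural_def by blast
qed

lemma natural_cases:
  assumes "is_natural n"
  obtains "n = emp" | m where "is_natural m" "n = insert_in m m"
proof -
  have "n = emp \<or> (\<exists>m. is_natural m \<and> n = insert_in m m)"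
    using assms by (rule natural_induct) (auto | rule definable definable_term_shift)+
  then show ?thesis using that by blast
qed

lemma natural_trans:
  assumes "is_natural n" "k \<epsilon> n" "j \<epsilon> k"
  shows "j \<epsilon> n"
proof -
  have "\<forall>k j. k \<epsilon> n \<longrightarrow> j \<epsilon> k \<longrightarrow> j \<epsilon> n"
    using assms(1) by (rule natural_induct) (auto | rule definable definable_term_shift)+
  then show ?thesis using assms by blast
qed

lemma natural_linear:
  assumes "is_natural m" "is_natural n"
  shows "m \<epsilon> n \<or> m = n \<or> n \<epsilon> m"
proof -
  have zero: "emp = n \<or> emp \<epsilon> n" if "is_natural n" for n
    using that by (rule natural_induct) (auto | rule definable definable_term_shift)+
  have succ: "insert_in k k = n \<or> insert_in k k \<epsilon> n" if "is_natural n" "k \<epsilon> n" for n k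
  proof -
    have "\<forall>k. k \<epsilon> n \<longrightarrow> insert_in k k = n \<or> insert_in k k \<epsilon> n"
      using that(1) by (rule natural_induct) (auto | rule definable definable_term_shift)+
    then show ?thesis using that by blast
  qed
  have "\<forall>n. is_natural n \<longrightarrow> m \<epsilon> n \<or> m = n \<or> n \<epsilon> m"
    using assms(1)
  proof (rule natural_induct)
    show "definable (\<lambda>v. \<forall>n. is_natural n \<longrightarrow> v 0 \<epsilon> n \<or> v 0 = n \<or> n \<epsilon> v 0)"
      by (rule definable definable_term_shift)+
  qed (use zero succ in \<open>auto; metis\<close>)+
  then show ?thesis using assms by blast
qed

text \<open>Foundation, applied to the set of all such naturals.\<close>

lemma natural_least:
  assumes "definable (\<lambda>v. P (v 0))" "is_natural n" "P n"
  shows "\<exists>m. is_natural m \<and> P m \<and> (\<forall>k. is_natural k \<and> P k \<longrightarrow> \<not> k \<epsilon> m)"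
proof -
  let ?w = "collect (\<lambda>n. is_natural n \<and> P n)"
  have w: "x \<epsilon> ?w \<longleftrightarrow> is_natural x \<and> P x" for x
    by (rule mem_collect_bounded[where a = omega])
      (simp add: mem_omega | rule assms definable definable_term_shift)+
  then have "\<not> is_empty ?w"
    using assms is_empty_def by blast
  then obtain m where "m \<epsilon> ?w" "\<not> (\<exists>z. z \<epsilon> m \<and> z \<epsilon> ?w)"
    using foundation by blast
  then show ?thesis
    using w by blast
qed

section \<open>Cardinalities of finite sets\<close>

definition has_card :: "'u \<Rightarrow> 'u \<Rightarrow> bool" where
  "has_card s n \<longleftrightarrow> is_natural n \<and> (\<exists>f. is_bijection f n s)"

lemma definable_has_card [definable]:
  "definable_term f \<Longrightarrow> definable_term g \<Longrightarrow> definable (\<lambda>v. has_card (f v) (g v))"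
  unfolding has_card_def by (assumption | rule definable definable_term_shift)+

lemma is_finite_iff: "is_finite s \<longleftrightarrow> (\<exists>n. has_card s n)"
  by (auto simp: is_finite_def has_card_def)

lemma bijectionD:
  assumes "is_bijection f a b"
  shows "maps_to f x y \<Longrightarrow> x \<epsilon> a" "maps_to f x y \<Longrightarrow> y \<epsilon> b"
    "x \<epsilon> a \<Longrightarrow> \<exists>y. maps_to f x y" "y \<epsilon> b \<Longrightarrow> \<exists>x. maps_to f x y"
    "maps_to f x y \<Longrightarrow> maps_to f x y' \<Longrightarrow> y = y'"
    "maps_to f x y \<Longrightarrow> maps_to f x' y \<Longrightarrow> x = x'"
proof -
  have D: "x \<epsilon> a \<and> y \<epsilon> b" if "maps_to f x y" for x y
    using that assms
    unfolding is_bijection_def is_injection_def is_function_def maps_to_iff is_pair_iff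
    by (metis kpair_eq_iff)
  then show "maps_to f x y \<Longrightarrow> x \<epsilon> a" "maps_to f x y \<Longrightarrow> y \<epsilon> b" by blast+
  show "x \<epsilon> a \<Longrightarrow> \<exists>y. maps_to f x y" "y \<epsilon> b \<Longrightarrow> \<exists>x. maps_to f x y"
    "maps_to f x y \<Longrightarrow> maps_to f x y' \<Longrightarrow> y = y'"
    "maps_to f x y \<Longrightarrow> maps_to f x' y \<Longrightarrow> x = x'"
    using assms D unfolding is_bijection_def is_injection_def is_surjection_def is_function_def
    by blast+
qed

lemma has_card_zero: "has_card s emp \<longleftrightarrow> s = emp"
proof
  assume "has_card s emp"
  then obtain f where f: "is_bijection f emp s" by (auto simp: has_card_def)
  show "s = emp"
    by (rule set_eqI) (use bijectionD(1)[OF f] bijectionD(4)[OF f] in force)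
next
  assume "s = emp"
  moreover have "\<exists>f. is_bijection f emp emp"
    by (rule bijectionI[where R = "\<lambda>_ _. True"]) (simp | rule definable)+
  ultimately show "has_card s emp"
    by (simp add: has_card_def natural_zero)
qed

lemma has_card_insert:
  assumes "has_card s n" "\<not> x \<epsilon> s"
  shows "has_card (insert_in x s) (insert_in n n)"
proof -
  from assms obtain f where f: "is_bijection f n s" "is_natural n"
    by (auto simp: has_card_def)
  note D = bijectionD[OF f(1)]
  have "\<exists>g. is_bijection g (insert_in n n) (insert_in x s)"
  proof (rule bijectionI[where R = "\<lambda>k y. maps_to f k y \<or> k = n \<and> y = x"])
    show "definable (\<lambda>v. maps_to f (v 0) (v 1) \<or> v 0 = n \<and> v 1 = x)"
      by (rule definable_term_var1 definable)+
    fix k assume "k \<epsilon> insert_in n n"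
    then show "\<exists>y. y \<epsilon> insert_in x s \<and> (maps_to f k y \<or> k = n \<and> y = x)"
      using D(2,3) by (metis mem_insert_in)
  next
    fix y assume "y \<epsilon> insert_in x s"
    then show "\<exists>k. k \<epsilon> insert_in n n \<and> (maps_to f k y \<or> k = n \<and> y = x)"
      using D(1,4) by (metis mem_insert_in)
  next
    fix k y y' assume "maps_to f k y \<or> k = n \<and> y = x" "maps_to f k y' \<or> k = n \<and> y' = x"
    then show "y = y'"
      using D(1,5) not_mem_self by metis
  next
    fix k k' y assume "maps_to f k y \<or> k = n \<and> y = x" "maps_to f k' y \<or> k' = n \<and> y = x"
    then show "k = k'"
      using D(2,6) assms(2) by metis
  qed
  then show ?thesis
    using f by (simp add: has_card_def natural_succ)
qed

text \<open>The value at \<open>n\<close> takes the place of \<open>x\<close>.\<close>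

lemma has_card_remove:
  assumes "has_card s (insert_in n n)" "x \<epsilon> s" "is_natural n"
  shows "has_card (remove x s) n"
proof -
  from assms obtain f where f: "is_bijection f (insert_in n n) s"
    by (auto simp: has_card_def)
  note D = bijectionD[OF f]
  have dom: "k \<epsilon> n \<or> k = n" if "maps_to f k y" for k y
    using D(1)[OF that] by auto
  have n: "k \<noteq> n" if "k \<epsilon> n" for k
    using that not_mem_self by blast
  obtain z where z: "maps_to f n z" using D(3)[of n] by auto
  have "\<exists>g. is_bijection g n (remove x s)"
  proof (rule bijectionI[where R = "\<lambda>k y. maps_to f k y \<or> maps_to f k x \<and> maps_to f n y"])
    show "definable (\<lambda>v. maps_to f (v 0) (v 1) \<or> maps_to f (v 0) x \<and> maps_to f n (v 1))"
      by (rule definable_term_var1 definable)+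
  next
    fix k assume k: "k \<epsilon> n"
    then obtain y where y: "maps_to f k y" using D(3)[of k] by auto
    show "\<exists>y. y \<epsilon> remove x s \<and> (maps_to f k y \<or> maps_to f k x \<and> maps_to f n y)"
    proof (cases "y = x")
      case True
      then have "z \<noteq> x" using D(6) y z n[OF k] by blast
      then show ?thesis using True y z D(2)[OF z] by auto
    next
      case False
      then show ?thesis using y D(2)[OF y] by auto
    qed
  next
    fix y assume y: "y \<epsilon> remove x s"
    then obtain k where k: "maps_to f k y" using D(4)[of y] by auto
    obtain j where j: "maps_to f j x" using D(4)[OF assms(2)] by auto
    show "\<exists>k. k \<epsilon> n \<and> (maps_to f k y \<or> maps_to f k x \<and> maps_to f n y)"
    proof (cases "k = n")
      case True
      then have "j \<noteq> n" using D(5) k j y by auto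
      then show ?thesis using dom[OF j] j k True by auto
    next
      case False
      then show ?thesis using dom[OF k] k by auto
    qed
  next
    fix k y y'
    assume "y \<epsilon> remove x s" "y' \<epsilon> remove x s"
      "maps_to f k y \<or> maps_to f k x \<and> maps_to f n y"
      "maps_to f k y' \<or> maps_to f k x \<and> maps_to f n y'"
    then show "y = y'"
      using D(5) by (metis mem_remove)
  next
    fix k k' y
    assume "k \<epsilon> n" "k' \<epsilon> n"
      "maps_to f k y \<or> maps_to f k x \<and> maps_to f n y"
      "maps_to f k' y \<or> maps_to f k' x \<and> maps_to f n y"
    then show "k = k'"
      using D(6) n by metis
  qed
  then show ?thesis
    using assms by (simp add: has_card_def)
qed

lemma has_card_natural: "has_card s n \<Longrightarrow> is_natural n"
  by (simp add: has_card_def)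

text \<open>Removing one element of \<open>s\<close> lowers both cardinalities by one, so the claim
  descends by induction on \<open>n\<close>.\<close>

lemma has_card_unique:
  assumes "has_card s n" "has_card s m"
  shows "m = n"
proof -
  have "\<forall>s m. has_card s n \<longrightarrow> has_card s m \<longrightarrow> m = n"
    using has_card_natural[OF assms(1)]
  proof (rule natural_induct)
    show "definable (\<lambda>v. \<forall>s m. has_card s (v 0) \<longrightarrow> has_card s m \<longrightarrow> m = v 0)"
      by (rule definable definable_term_shift)+
    show "\<forall>s m. has_card s emp \<longrightarrow> has_card s m \<longrightarrow> m = emp"
    proof (intro allI impI)
      fix s m assume "has_card s emp" and m: "has_card s m"
      then have "s = emp" by (simp add: has_card_zero)
      then obtain f where f: "is_bijection f m emp" using m by (auto simp: has_card_def)
      show "m = emp"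
        by (rule set_eqI) (use bijectionD(2)[OF f] bijectionD(3)[OF f] in force)
    qed
  next
    fix n assume n: "is_natural n" and IH: "\<forall>s m. has_card s n \<longrightarrow> has_card s m \<longrightarrow> m = n"
    show "\<forall>s m. has_card s (insert_in n n) \<longrightarrow> has_card s m \<longrightarrow> m = insert_in n n"
    proof (intro allI impI)
      fix s m assume s: "has_card s (insert_in n n)" and m: "has_card s m"
      obtain f where f: "is_bijection f (insert_in n n) s" using s by (auto simp: has_card_def)
      obtain x where x: "x \<epsilon> s"
        using bijectionD(3)[OF f, of n] bijectionD(2)[OF f, of n] by auto
      have "m \<noteq> emp" using m x has_card_zero by auto
      then obtain k where k: "is_natural k" "m = insert_in k k"
        using natural_cases[OF has_card_natural[OF m]] by metis
      have "has_card (remove x s) k" "has_card (remove x s) n"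
        using has_card_remove s m x k n by auto
      then show "m = insert_in n n"
        using IH k by auto
    qed
  qed
  then show ?thesis using assms by blast
qed

text \<open>Finite sets are Dedekind finite. Through this the number of earlier members determines a
  member within its block.\<close>

lemma has_card_subset_eq:
  assumes "has_card a n" "has_card b n" "is_subset a b"
  shows "a = b"
proof -
  have "\<forall>a b. has_card a n \<longrightarrow> has_card b n \<longrightarrow> is_subset a b \<longrightarrow> a = b"
    using has_card_natural[OF assms(1)]
  proof (rule natural_induct)
    show "definable (\<lambda>v. \<forall>a b. has_card a (v 0) \<longrightarrow> has_card b (v 0) \<longrightarrow> is_subset a b \<longrightarrow> a = b)"
      by (rule definable definable_term_shift)+
    show "\<forall>a b. has_card a emp \<longrightarrow> has_card b emp \<longrightarrow> is_subset a b \<longrightarrow> a = b"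
      by (simp add: has_card_zero)
  next
    fix n assume n: "is_natural n"
      and IH: "\<forall>a b. has_card a n \<longrightarrow> has_card b n \<longrightarrow> is_subset a b \<longrightarrow> a = b"
    show "\<forall>a b. has_card a (insert_in n n) \<longrightarrow> has_card b (insert_in n n) \<longrightarrow> is_subset a b \<longrightarrow> a = b"
    proof (intro allI impI)
      fix a b assume a: "has_card a (insert_in n n)" and b: "has_card b (insert_in n n)"
        and ab: "is_subset a b"
      obtain f where f: "is_bijection f (insert_in n n) a" using a by (auto simp: has_card_def)
      obtain x where x: "x \<epsilon> a"
        using bijectionD(3)[OF f, of n] bijectionD(2)[OF f, of n] by auto
      then have xb: "x \<epsilon> b" using ab by (simp add: is_subset_def)
      have "has_card (remove x a) n" "has_card (remove x b) n"
        using has_card_remove a b x xb n by auto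
      moreover have "is_subset (remove x a) (remove x b)"
        using ab by (simp add: is_subset_def)
      ultimately have "remove x a = remove x b"
        using IH by blast
      then show "a = b"
        using insert_remove x xb by metis
    qed
  qed
  then show ?thesis using assms by blast
qed

section \<open>Induction on finite sets, finite unions and maxima\<close>

lemma finite_emp: "is_finite emp"
  using has_card_zero is_finite_iff by blast

lemma finite_insert:
  assumes "is_finite s"
  shows "is_finite (insert_in x s)"
proof (cases "x \<epsilon> s")
  case True
  then have "insert_in x s = s" by (intro set_eqI) auto
  then show ?thesis using assms by simp
next
  case False
  obtain n where "has_card s n" using assms is_finite_iff by auto
  then have "has_card (insert_in x s) (insert_in n n)"
    using False by (rule has_card_insert)
  then show ?thesis using is_finite_iff by blast
qed

text \<open>Internal induction on the cardinality. \<open>s\<close> is quantified inside the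
  induction formula because the element removed varies.\<close>

lemma finite_induct_in [consumes 1, case_names definable emp insert]:
  assumes "is_finite s" "definable (\<lambda>v. P (v 0))"
    and "P emp" "\<And>x s. is_finite s \<Longrightarrow> P s \<Longrightarrow> \<not> x \<epsilon> s \<Longrightarrow> P (insert_in x s)"
  shows "P s"
proof -
  obtain n where n: "has_card s n" using assms(1) is_finite_iff by blast
  have "\<forall>s. has_card s n \<longrightarrow> P s"
    using has_card_natural[OF n]
  proof (rule natural_induct)
    show "definable (\<lambda>v. \<forall>s. has_card s (v 0) \<longrightarrow> P s)"
      by (rule definable_subst[OF _ assms(2)] definable definable_term_shift)+
    show "\<forall>s. has_card s emp \<longrightarrow> P s"
      using assms(3) by (simp add: has_card_zero)
  next
    fix n assume n: "is_natural n" and IH: "\<forall>s. has_card s n \<longrightarrow> P s"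
    show "\<forall>s. has_card s (insert_in n n) \<longrightarrow> P s"
    proof (intro allI impI)
      fix s assume s: "has_card s (insert_in n n)"
      obtain f where f: "is_bijection f (insert_in n n) s" using s by (auto simp: has_card_def)
      obtain x where x: "x \<epsilon> s"
        using bijectionD(3)[OF f, of n] bijectionD(2)[OF f, of n] by auto
      have r: "has_card (remove x s) n"
        using has_card_remove s x n by auto
      then have "P (insert_in x (remove x s))"
        using IH by (intro assms(4)) (auto simp: is_finite_iff)
      then show "P s"
        using insert_remove x by simp
    qed
  qed
  then show ?thesis using n by blast
qed

lemma finite_subset_in:
  assumes "is_finite s" "is_subset t s"
  shows "is_finite t"
proof -
  have "\<forall>t. is_subset t s \<longrightarrow> is_finite t"
    using assms(1)
  proof (rule finite_induct_in)
    show "definable (\<lambda>v. \<forall>t. is_subset t (v 0) \<longrightarrow> is_finite t)"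
      by (rule definable definable_term_shift)+
    show "\<forall>t. is_subset t emp \<longrightarrow> is_finite t"
    proof (intro allI impI)
      fix t assume "is_subset t emp"
      then have "t = emp" by (intro set_eqI) (simp add: is_subset_def)
      then show "is_finite t" by (simp add: finite_emp)
    qed
  next
    fix x s assume IH: "\<forall>t. is_subset t s \<longrightarrow> is_finite t"
    show "\<forall>t. is_subset t (insert_in x s) \<longrightarrow> is_finite t"
    proof (intro allI impI)
      fix t assume "is_subset t (insert_in x s)"
      then have "is_subset (remove x t) s"
        by (auto simp: is_subset_def)
      then have "is_finite (remove x t)" using IH by blast
      then show "is_finite t"
        using insert_remove[of x t] finite_insert[of "remove x t" x] remove_insert
        by (metis mem_remove set_eqI)
    qed
  qed
  then show ?thesis using assms by blast
qed

lemma finite_union2: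
  assumes "is_finite s" "is_finite t"
  shows "is_finite (union2 s t)"
  using assms(1)
proof (rule finite_induct_in)
  show "definable (\<lambda>v. is_finite (union2 (v 0) t))"
    by (rule definable definable_term_shift)+
  have "union2 emp t = t" by (rule set_eqI) simp
  then show "is_finite (union2 emp t)" using assms by simp
next
  fix x s assume "is_finite (union2 s t)"
  moreover have "union2 (insert_in x s) t = insert_in x (union2 s t)"
    by (rule set_eqI) auto
  ultimately show "is_finite (union2 (insert_in x s) t)"
    by (simp add: finite_insert)
qed

text \<open>No finite set is chosen for each \<open>x\<close>: the induction on \<open>s\<close>
  uses one witness at a time and merges it with the bound already obtained.\<close>

lemma finite_UN:
  assumes "is_finite s" "definable (\<lambda>v. R (v 0) (v 1))"
    and "\<And>x. x \<epsilon> s \<Longrightarrow> \<exists>t. is_finite t \<and> (\<forall>y. R x y \<longrightarrow> y \<epsilon> t)"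
  shows "\<exists>t. is_finite t \<and> (\<forall>x y. x \<epsilon> s \<and> R x y \<longrightarrow> y \<epsilon> t)"
proof -
  have "(\<forall>x. x \<epsilon> s \<longrightarrow> (\<exists>t. is_finite t \<and> (\<forall>y. R x y \<longrightarrow> y \<epsilon> t))) \<longrightarrow>
    (\<exists>t. is_finite t \<and> (\<forall>x y. x \<epsilon> s \<and> R x y \<longrightarrow> y \<epsilon> t))"
    using assms(1)
  proof (rule finite_induct_in)
    show "definable (\<lambda>v. (\<forall>x. x \<epsilon> v 0 \<longrightarrow> (\<exists>t. is_finite t \<and> (\<forall>y. R x y \<longrightarrow> y \<epsilon> t))) \<longrightarrow>
      (\<exists>t. is_finite t \<and> (\<forall>x y. x \<epsilon> v 0 \<and> R x y \<longrightarrow> y \<epsilon> t)))"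
      by (rule definable_subst2[OF assms(2)] definable definable_term_shift)+
  next
    fix x s
    assume IH: "(\<forall>x. x \<epsilon> s \<longrightarrow> (\<exists>t. is_finite t \<and> (\<forall>y. R x y \<longrightarrow> y \<epsilon> t))) \<longrightarrow>
      (\<exists>t. is_finite t \<and> (\<forall>x y. x \<epsilon> s \<and> R x y \<longrightarrow> y \<epsilon> t))"
    show "(\<forall>z. z \<epsilon> insert_in x s \<longrightarrow> (\<exists>t. is_finite t \<and> (\<forall>y. R z y \<longrightarrow> y \<epsilon> t))) \<longrightarrow>
      (\<exists>t. is_finite t \<and> (\<forall>z y. z \<epsilon> insert_in x s \<and> R z y \<longrightarrow> y \<epsilon> t))"
    proof
      assume *: "\<forall>z. z \<epsilon> insert_in x s \<longrightarrow> (\<exists>t. is_finite t \<and> (\<forall>y. R z y \<longrightarrow> y \<epsilon> t))"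
      then obtain t where t: "is_finite t" "\<And>y. R x y \<Longrightarrow> y \<epsilon> t" by auto
      from * IH obtain u where u: "is_finite u" "\<And>z y. z \<epsilon> s \<Longrightarrow> R z y \<Longrightarrow> y \<epsilon> u"
        by auto
      show "\<exists>t. is_finite t \<and> (\<forall>z y. z \<epsilon> insert_in x s \<and> R z y \<longrightarrow> y \<epsilon> t)"
        by (rule exI[of _ "union2 t u"]) (use t u finite_union2 in auto)
    qed
  qed (use finite_emp in auto)
  then show ?thesis using assms(3) by blast
qed

text \<open>Transitivity and linearity are known on \<open>s\<close> only, so the induction runs
  over the subsets \<open>t\<close> of \<open>s\<close>.\<close>

lemma finite_has_max:
  assumes "is_finite s" "x \<epsilon> s" "definable (\<lambda>v. L (v 0) (v 1))"
    and trans: "\<And>x y z. x \<epsilon> s \<Longrightarrow> y \<epsilon> s \<Longrightarrow> z \<epsilon> s \<Longrightarrow> L x y \<Longrightarrow> L y z \<Longrightarrow> L x z"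
    and linear: "\<And>x y. x \<epsilon> s \<Longrightarrow> y \<epsilon> s \<Longrightarrow> x = y \<or> L x y \<or> L y x"
  shows "\<exists>m. m \<epsilon> s \<and> (\<forall>y. y \<epsilon> s \<longrightarrow> y = m \<or> L y m)"
proof -
  have main: "is_subset t s \<longrightarrow> t \<noteq> emp \<longrightarrow> (\<exists>m. m \<epsilon> t \<and> (\<forall>y. y \<epsilon> t \<longrightarrow> y = m \<or> L y m))"
    if "is_finite t" for t
    using that
  proof (rule finite_induct_in)
    show "definable (\<lambda>v. is_subset (v 0) s \<longrightarrow> v 0 \<noteq> emp \<longrightarrow>
      (\<exists>m. m \<epsilon> v 0 \<and> (\<forall>y. y \<epsilon> v 0 \<longrightarrow> y = m \<or> L y m)))"
      by (rule definable_subst2[OF assms(3)] definable definable_term_shift)+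
  next
    fix x t
    assume IH: "is_subset t s \<longrightarrow> t \<noteq> emp \<longrightarrow> (\<exists>m. m \<epsilon> t \<and> (\<forall>y. y \<epsilon> t \<longrightarrow> y = m \<or> L y m))"
    show "is_subset (insert_in x t) s \<longrightarrow> insert_in x t \<noteq> emp \<longrightarrow>
      (\<exists>m. m \<epsilon> insert_in x t \<and> (\<forall>y. y \<epsilon> insert_in x t \<longrightarrow> y = m \<or> L y m))"
    proof (cases "t = emp")
      case True
      then show ?thesis by auto
    next
      case False
      show ?thesis
      proof (intro impI)
        assume sub: "is_subset (insert_in x t) s"
        then have "is_subset t s" by (simp add: is_subset_def)
        with False IH obtain m where m: "m \<epsilon> t" "\<And>y. y \<epsilon> t \<Longrightarrow> y = m \<or> L y m" by blast
        have s: "x \<epsilon> s" "\<And>y. y \<epsilon> t \<Longrightarrow> y \<epsilon> s" using sub by (simp_all add: is_subset_def)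
        have "x = m \<or> L x m \<or> L m x"
          using linear m s by blast
        then show "\<exists>m. m \<epsilon> insert_in x t \<and> (\<forall>y. y \<epsilon> insert_in x t \<longrightarrow> y = m \<or> L y m)"
        proof (elim disjE)
          assume mx: "L m x"
          have "y = x \<or> L y x" if y: "y \<epsilon> insert_in x t" for y
          proof (cases "y = x \<or> y = m")
            case False
            with y have "y \<epsilon> t" by simp
            then have "L y m" using m False by blast
            then show ?thesis
              using trans[OF s(2) s(2) s(1) _ mx] \<open>y \<epsilon> t\<close> m(1) by blast
          qed (use mx in blast)
          then show ?thesis
            by (intro exI[of _ x]) simp
        qed (use m in auto)
      qed
    qed
  qed simp
  have "s \<noteq> emp" using assms(2) by auto
  then show ?thesis
    using main[OF assms(1)] by (simp add: is_subset_def)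
qed

end

section \<open>Covering the subsets of a set by finitely many at each point\<close>

text \<open>These assumptions are to be refuted. \<open>cov\<close> is a relation because a finite
  block comes without an ordering of its elements, and its definability is assumed because it enters
  every later comprehension.\<close>

locale finite_cover = ZF_model mem for mem :: "'u \<Rightarrow> 'u \<Rightarrow> bool" (infix \<open>\<epsilon>\<close> 50) +
  fixes X :: 'u and cov :: "'u \<Rightarrow> 'u \<Rightarrow> bool"
  assumes definable_cov': "definable (\<lambda>v. cov (v 0) (v 1))"
    and cov_subset: "cov x S \<Longrightarrow> is_subset S X"
    and cov_finite: "x \<epsilon> X \<Longrightarrow> \<exists>t. is_finite t \<and> (\<forall>S. cov x S \<longrightarrow> S \<epsilon> t)"
    and cov_exhausts: "is_subset S X \<Longrightarrow> \<exists>x. x \<epsilon> X \<and> cov x S"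
    and infinite_X: "\<not> is_finite X"
begin

lemmas definable_cov [definable] = definable_subst2[OF definable_cov']

text \<open>Strict bounds on the sizes of the finite sets covered; infinite ones have no cardinality
  in this sense and do not count. Points are compared by their whole sets of bounds, which are final
  segments of the naturals, so no least bound has to be named.\<close>

definition bounds :: "'u \<Rightarrow> 'u \<Rightarrow> bool" where
  "bounds x n \<longleftrightarrow> is_natural n \<and> (\<forall>S m. cov x S \<and> has_card S m \<longrightarrow> m \<epsilon> n)"

text \<open>Below, \<open>r\<close> is the set of nonempty initial segments of a well-ordering of \<open>union_of r\<close>, a set
  of subsets of \<open>X\<close>; \<open>precedes r\<close> recovers that ordering.\<close>

definition precedes :: "'u \<Rightarrow> 'u \<Rightarrow> 'u \<Rightarrow> bool" where
  "precedes r a b \<longleftrightarrow> (\<exists>I. I \<epsilon> r \<and> a \<epsilon> I \<and> \<not> b \<epsilon> I)"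

text \<open>The finite sets of covered members are compared at their largest difference, like binary
  expansions. On the finite subsets of a well-ordered set this is again a well-ordering.\<close>

definition lex :: "'u \<Rightarrow> 'u \<Rightarrow> 'u \<Rightarrow> bool" where
  "lex r x y \<longleftrightarrow> (\<exists>a. a \<epsilon> union_of r \<and> cov y a \<and> \<not> cov x a \<and>
    (\<forall>b. b \<epsilon> union_of r \<and> precedes r a b \<longrightarrow> (cov x b \<longleftrightarrow> cov y b)))"

definition same_bounds :: "'u \<Rightarrow> 'u \<Rightarrow> bool" where
  "same_bounds x y \<longleftrightarrow> (\<forall>n. bounds x n \<longleftrightarrow> bounds y n)"

definition less :: "'u \<Rightarrow> 'u \<Rightarrow> 'u \<Rightarrow> bool" where
  "less r x y \<longleftrightarrow> (\<exists>n. bounds x n \<and> \<not> bounds y n) \<or> same_bounds x y \<and> lex r x y"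

definition similar :: "'u \<Rightarrow> 'u \<Rightarrow> 'u \<Rightarrow> bool" where
  "similar r x y \<longleftrightarrow> same_bounds x y \<and> (\<forall>a. a \<epsilon> union_of r \<longrightarrow> (cov x a \<longleftrightarrow> cov y a))"

text \<open>The classes of the prewellordering \<open>less r\<close> are represented by the sets of their predecessors,
  which makes their ordering inclusion.\<close>

definition seg :: "'u \<Rightarrow> 'u \<Rightarrow> 'u" where
  "seg r x = collect (\<lambda>y. y \<epsilon> X \<and> less r y x)"

definition segs :: "'u \<Rightarrow> 'u" where
  "segs r = collect (\<lambda>c. \<exists>x. x \<epsilon> X \<and> c = seg r x)"

text \<open>The first class that covers \<open>a\<close>, as the intersection of all such segments.\<close>

definition first_seg :: "'u \<Rightarrow> 'u \<Rightarrow> 'u" where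
  "first_seg r a = collect (\<lambda>y. y \<epsilon> X \<and> (\<forall>x. x \<epsilon> X \<and> cov x a \<longrightarrow> less r y x))"

text \<open>One of \<open>between r c d\<close> and \<open>between r d c\<close> is empty, and the equivalence classes of \<open>near r\<close> are
  the blocks of type \<open>\<omega>\<close>.\<close>

definition between :: "'u \<Rightarrow> 'u \<Rightarrow> 'u \<Rightarrow> 'u" where
  "between r c d = collect (\<lambda>e. e \<epsilon> segs r \<and> is_subset c e \<and> is_subset e d \<and> e \<noteq> d)"

definition near :: "'u \<Rightarrow> 'u \<Rightarrow> 'u \<Rightarrow> bool" where
  "near r c d \<longleftrightarrow> is_finite (between r c d) \<and> is_finite (between r d c)"

text \<open>Its cardinality is the position of \<open>c\<close> in its block, counted from
  zero.\<close>

definition preds :: "'u \<Rightarrow> 'u \<Rightarrow> 'u" where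
  "preds r c = collect (\<lambda>d. d \<epsilon> segs r \<and> is_subset d c \<and> d \<noteq> c \<and> near r d c)"

text \<open>Members are ordered by their first class, with ties broken by the given well-ordering.
  The cardinality is the position of \<open>a\<close> among the members that first appear in the
  same block.\<close>

definition earlier :: "'u \<Rightarrow> 'u \<Rightarrow> 'u" where
  "earlier r a = collect (\<lambda>b. b \<epsilon> union_of r \<and> near r (first_seg r b) (first_seg r a) \<and>
    (is_subset (first_seg r b) (first_seg r a) \<and> first_seg r b \<noteq> first_seg r a \<or>
     first_seg r b = first_seg r a \<and> precedes r b a))"

text \<open>A partial map from points to members, constant on classes: same block and same
  position.\<close>

definition matches :: "'u \<Rightarrow> 'u \<Rightarrow> 'u \<Rightarrow> bool" where
  "matches r x a \<longleftrightarrow> a \<epsilon> union_of r \<and> near r (seg r x) (first_seg r a) \<and>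
    (\<exists>n. has_card (earlier r a) n \<and> has_card (preds r (seg r x)) n)"

text \<open>Cantor's diagonal set along this partial map; points without a match stay
  outside.\<close>

definition diagonal :: "'u \<Rightarrow> 'u" where
  "diagonal r = collect (\<lambda>x. x \<epsilon> X \<and> (\<exists>a. matches r x a \<and> \<not> x \<epsilon> a))"

lemma definable_bounds [definable]:
  "definable_term f \<Longrightarrow> definable_term g \<Longrightarrow> definable (\<lambda>v. bounds (f v) (g v))"
  unfolding bounds_def by (assumption | rule definable definable_term_shift)+

lemma definable_precedes [definable]:
  "definable_term f \<Longrightarrow> definable_term g \<Longrightarrow> definable_term h \<Longrightarrow>
    definable (\<lambda>v. precedes (f v) (g v) (h v))"
  unfolding precedes_def by (assumption | rule definable definable_term_shift)+

lemma definable_lex [definable]: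
  "definable_term f \<Longrightarrow> definable_term g \<Longrightarrow> definable_term h \<Longrightarrow>
    definable (\<lambda>v. lex (f v) (g v) (h v))"
  unfolding lex_def by (assumption | rule definable definable_term_shift)+

lemma definable_same_bounds [definable]:
  "definable_term f \<Longrightarrow> definable_term g \<Longrightarrow> definable (\<lambda>v. same_bounds (f v) (g v))"
  unfolding same_bounds_def by (assumption | rule definable definable_term_shift)+

lemma definable_less [definable]:
  "definable_term f \<Longrightarrow> definable_term g \<Longrightarrow> definable_term h \<Longrightarrow>
    definable (\<lambda>v. less (f v) (g v) (h v))"
  unfolding less_def by (assumption | rule definable definable_term_shift)+

lemma definable_seg [definable]:
  "definable_term f \<Longrightarrow> definable_term g \<Longrightarrow> definable_term (\<lambda>v. seg (f v) (g v))"
  unfolding seg_def by (assumption | rule definable definable_term_shift)+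

lemma definable_segs [definable]:
  "definable_term f \<Longrightarrow> definable_term (\<lambda>v. segs (f v))"
  unfolding segs_def by (assumption | rule definable definable_term_shift)+

lemma definable_first_seg [definable]:
  "definable_term f \<Longrightarrow> definable_term g \<Longrightarrow> definable_term (\<lambda>v. first_seg (f v) (g v))"
  unfolding first_seg_def by (assumption | rule definable definable_term_shift)+

lemma definable_between [definable]:
  "definable_term f \<Longrightarrow> definable_term g \<Longrightarrow> definable_term h \<Longrightarrow>
    definable_term (\<lambda>v. between (f v) (g v) (h v))"
  unfolding between_def by (assumption | rule definable definable_term_shift)+

lemma definable_near [definable]:
  "definable_term f \<Longrightarrow> definable_term g \<Longrightarrow> definable_term h \<Longrightarrow>
    definable (\<lambda>v. near (f v) (g v) (h v))"
  unfolding near_def by (assumption | rule definable definable_term_shift)+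

lemma definable_preds [definable]:
  "definable_term f \<Longrightarrow> definable_term g \<Longrightarrow> definable_term (\<lambda>v. preds (f v) (g v))"
  unfolding preds_def by (assumption | rule definable definable_term_shift)+

lemma definable_earlier [definable]:
  "definable_term f \<Longrightarrow> definable_term g \<Longrightarrow> definable_term (\<lambda>v. earlier (f v) (g v))"
  unfolding earlier_def by (assumption | rule definable definable_term_shift)+

lemma definable_matches [definable]:
  "definable_term f \<Longrightarrow> definable_term g \<Longrightarrow> definable_term h \<Longrightarrow>
    definable (\<lambda>v. matches (f v) (g v) (h v))"
  unfolding matches_def by (assumption | rule definable definable_term_shift)+

lemma definable_diagonal [definable]:
  "definable_term f \<Longrightarrow> definable_term (\<lambda>v. diagonal (f v))"
  unfolding diagonal_def by (assumption | rule definable definable_term_shift)+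

lemma mem_seg: "y \<epsilon> seg r x \<longleftrightarrow> y \<epsilon> X \<and> less r y x"
  unfolding seg_def
  by (rule mem_collect_bounded[where a = X]) (blast | rule definable definable_term_shift)+

lemma mem_segs: "c \<epsilon> segs r \<longleftrightarrow> (\<exists>x. x \<epsilon> X \<and> c = seg r x)"
  unfolding segs_def
proof (rule mem_collect_bounded[where a = "pow X"])
  show "c \<epsilon> pow X" if "\<exists>x. x \<epsilon> X \<and> c = seg r x" for c
    using that by (auto simp: is_subset_def mem_seg)
qed (rule definable definable_term_shift)+

lemma mem_first_seg:
  "y \<epsilon> first_seg r a \<longleftrightarrow> y \<epsilon> X \<and> (\<forall>x. x \<epsilon> X \<and> cov x a \<longrightarrow> less r y x)"
  unfolding first_seg_def
  by (rule mem_collect_bounded[where a = X]) (blast | rule definable definable_term_shift)+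

lemma mem_between:
  "e \<epsilon> between r c d \<longleftrightarrow> e \<epsilon> segs r \<and> is_subset c e \<and> is_subset e d \<and> e \<noteq> d"
  unfolding between_def
  by (rule mem_collect_bounded[where a = "segs r"]) (blast | rule definable definable_term_shift)+

lemma mem_preds:
  "d \<epsilon> preds r c \<longleftrightarrow> d \<epsilon> segs r \<and> is_subset d c \<and> d \<noteq> c \<and> near r d c"
  unfolding preds_def
  by (rule mem_collect_bounded[where a = "segs r"]) (blast | rule definable definable_term_shift)+

lemma mem_earlier:
  "b \<epsilon> earlier r a \<longleftrightarrow> b \<epsilon> union_of r \<and> near r (first_seg r b) (first_seg r a) \<and>
    (is_subset (first_seg r b) (first_seg r a) \<and> first_seg r b \<noteq> first_seg r a \<or>
     first_seg r b = first_seg r a \<and> precedes r b a)"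
  unfolding earlier_def
  by (rule mem_collect_bounded[where a = "union_of r"])
    (blast | rule definable definable_term_shift)+

lemma mem_diagonal: "x \<epsilon> diagonal r \<longleftrightarrow> x \<epsilon> X \<and> (\<exists>a. matches r x a \<and> \<not> x \<epsilon> a)"
  unfolding diagonal_def
  by (rule mem_collect_bounded[where a = X]) (blast | rule definable definable_term_shift)+

section \<open>Bounds on the covered cardinalities\<close>

lemma subset_has_card:
  assumes "is_natural n"
  shows "\<exists>S. is_subset S X \<and> has_card S n"
  using assms
proof (rule natural_induct)
  show "definable (\<lambda>v. \<exists>S. is_subset S X \<and> has_card S (v 0))"
    by (rule definable definable_term_shift)+
  have "is_subset emp X \<and> has_card emp emp"
    by (simp add: is_subset_def has_card_zero)
  then show "\<exists>S. is_subset S X \<and> has_card S emp" ..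
next
  fix n assume "\<exists>S. is_subset S X \<and> has_card S n"
  then obtain S where S: "is_subset S X" "has_card S n" by blast
  then have "S \<noteq> X" using infinite_X is_finite_iff by auto
  then obtain x where "x \<epsilon> X" "\<not> x \<epsilon> S"
    using S(1) set_eqI[of S X] by (auto simp: is_subset_def)
  then have "is_subset (insert_in x S) X \<and> has_card (insert_in x S) (insert_in n n)"
    using S has_card_insert by (simp add: is_subset_def)
  then show "\<exists>S. is_subset S X \<and> has_card S (insert_in n n)" ..
qed

lemma bounds_exists:
  assumes "x \<epsilon> X"
  shows "\<exists>n. bounds x n"
proof -
  obtain t where t: "is_finite t" "\<And>S. cov x S \<Longrightarrow> S \<epsilon> t"
    using cov_finite[OF assms] by blast
  have "\<exists>n. is_natural n \<and> (\<forall>S m. S \<epsilon> t \<and> has_card S m \<longrightarrow> m \<epsilon> n)"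
    using t(1)
  proof (rule finite_induct_in)
    show "definable (\<lambda>v. \<exists>n. is_natural n \<and> (\<forall>S m. S \<epsilon> v 0 \<and> has_card S m \<longrightarrow> m \<epsilon> n))"
      by (rule definable definable_term_shift)+
    show "\<exists>n. is_natural n \<and> (\<forall>S m. S \<epsilon> emp \<and> has_card S m \<longrightarrow> m \<epsilon> n)"
      using natural_zero by auto
  next
    fix S0 t
    assume "\<exists>n. is_natural n \<and> (\<forall>S m. S \<epsilon> t \<and> has_card S m \<longrightarrow> m \<epsilon> n)"
    then obtain n where n: "is_natural n" "\<And>S m. S \<epsilon> t \<Longrightarrow> has_card S m \<Longrightarrow> m \<epsilon> n" by blast
    show "\<exists>n. is_natural n \<and> (\<forall>S m. S \<epsilon> insert_in S0 t \<and> has_card S m \<longrightarrow> m \<epsilon> n)"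
    \<comment> \<open>If \<open>S0\<close> is infinite or has its cardinality below
      \<open>n\<close>, the old bound remains valid. Otherwise the successor of that cardinality
      exceeds everything so far.\<close>
    proof (cases "\<exists>m. has_card S0 m \<and> \<not> m \<epsilon> n")
      case False
      then show ?thesis using n by (intro exI[of _ n]) auto
    next
      case True
      then obtain m where m: "has_card S0 m" "\<not> m \<epsilon> n" by blast
      then have "m = n \<or> n \<epsilon> m"
        using natural_linear has_card_natural n(1) by blast
      then have "k \<epsilon> insert_in m m" if "k \<epsilon> n" for k
        using that natural_trans[OF has_card_natural[OF m(1)]] by auto
      moreover have "m' = m" if "has_card S0 m'" for m'
        using has_card_unique that m(1) by blast
      ultimately show ?thesis
        using n m natural_succ has_card_natural
        by (intro exI[of _ "insert_in m m"]) (metis mem_insert_in)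
    qed
  qed
  then show ?thesis
    using t(2) unfolding bounds_def by blast
qed

lemma bounds_upward:
  assumes "bounds x n" "is_natural m" "n \<epsilon> m"
  shows "bounds x m"
  using assms natural_trans unfolding bounds_def by blast

lemma bounds_linear: "same_bounds x y \<or> (\<exists>n. bounds x n \<and> \<not> bounds y n) \<or> (\<exists>n. bounds y n \<and> \<not> bounds x n)"
  unfolding same_bounds_def by blast

text \<open>Upward closed sets of naturals are nested, so one separating bound gives an
  inclusion.\<close>

lemma bounds_strict_asym:
  assumes "bounds x n" "\<not> bounds y n" "bounds y m"
  shows "bounds x m"
proof -
  have "is_natural n" "is_natural m"
    using assms by (simp_all add: bounds_def)
  then have "n \<epsilon> m \<or> n = m \<or> m \<epsilon> n"
    by (rule natural_linear)
  then show ?thesis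
    using assms bounds_upward \<open>is_natural n\<close> \<open>is_natural m\<close> by blast
qed

text \<open>Bounds are strict: a point covering a set of cardinality exactly \<open>n\<close> is not
  bounded by \<open>n\<close>. This combines the infinity of \<open>X\<close> with the
  exhaustiveness of the cover.\<close>

lemma bounds_no_max:
  assumes "x \<epsilon> X"
  shows "\<exists>y n. y \<epsilon> X \<and> bounds x n \<and> \<not> bounds y n"
proof -
  obtain n where n: "bounds x n" using bounds_exists[OF assms] ..
  then have "is_natural n" by (simp add: bounds_def)
  then obtain S where S: "is_subset S X" "has_card S n"
    using subset_has_card by blast
  obtain y where "y \<epsilon> X" "cov y S" using cov_exhausts[OF S(1)] by blast
  then have "\<not> bounds y n"
    using S(2) not_mem_self unfolding bounds_def by blast
  then show ?thesis using n \<open>y \<epsilon> X\<close> by blast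
qed

end

section \<open>The diagonal set of a well-ordered family of subsets\<close>

text \<open>What the construction of the diagonal set requires of \<open>r\<close>;
  \<open>good_stage\<close> supplies it for the families met in the iteration.\<close>

locale stage = finite_cover mem X cov
  for mem :: "'u \<Rightarrow> 'u \<Rightarrow> bool" (infix \<open>\<epsilon>\<close> 50) and X :: 'u and cov +
  fixes r :: 'u
  assumes chain: "I \<epsilon> r \<Longrightarrow> J \<epsilon> r \<Longrightarrow> is_subset I J \<or> is_subset J I"
    and least: "q \<epsilon> Q \<Longrightarrow> is_subset Q (union_of r) \<Longrightarrow>
      \<exists>m. m \<epsilon> Q \<and> (\<forall>y. y \<epsilon> Q \<longrightarrow> \<not> precedes r y m)"
    and linear: "a \<epsilon> union_of r \<Longrightarrow> b \<epsilon> union_of r \<Longrightarrow> a = b \<or> precedes r a b \<or> precedes r b a"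
    and mem_stage: "a \<epsilon> union_of r \<Longrightarrow> is_subset a X"
begin

abbreviation before :: "'u \<Rightarrow> 'u \<Rightarrow> bool" where "before \<equiv> precedes r"

section \<open>The lexicographic order on covered members\<close>

lemma before_irrefl: "\<not> before a a"
  by (auto simp: precedes_def)

lemma before_trans: "before a b \<Longrightarrow> before b c \<Longrightarrow> before a c"
  using chain unfolding precedes_def is_subset_def by metis

lemma before_asym: "before a b \<Longrightarrow> \<not> before b a"
  using before_trans before_irrefl by blast

lemma covered:
  assumes "a \<epsilon> union_of r"
  obtains x where "x \<epsilon> X" "cov x a"
  using cov_exhausts[OF mem_stage[OF assms]] that by blast

text \<open>The two deciding members differ, as \<open>y\<close> covers only the first; the larger
  of them decides between \<open>x\<close> and \<open>z\<close>.\<close>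

lemma lex_trans:
  assumes "lex r x y" "lex r y z"
  shows "lex r x z"
proof -
  from assms(1) obtain a where a: "a \<epsilon> union_of r" "cov y a" "\<not> cov x a"
    "\<And>c. c \<epsilon> union_of r \<Longrightarrow> before a c \<Longrightarrow> cov x c \<longleftrightarrow> cov y c"
    unfolding lex_def by blast
  from assms(2) obtain b where b: "b \<epsilon> union_of r" "cov z b" "\<not> cov y b"
    "\<And>c. c \<epsilon> union_of r \<Longrightarrow> before b c \<Longrightarrow> cov y c \<longleftrightarrow> cov z c"
    unfolding lex_def by blast
  have "a \<noteq> b" using a b by blast
  then consider "before a b" | "before b a" using linear a b by blast
  then show ?thesis
  proof cases
    case 1
    then have "\<not> cov x b" using a(4)[OF b(1)] b(3) by blast
    then show ?thesis unfolding lex_def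
      using 1 a b before_trans by (intro exI[of _ b]) blast
  next
    case 2
    then have "cov z a" using b(4)[OF a(1)] a(2) by blast
    then show ?thesis unfolding lex_def
      using 2 a b before_trans by (intro exI[of _ a]) blast
  qed
qed

lemma lex_irrefl: "\<not> lex r x x"
  unfolding lex_def by blast

text \<open>Only finitely many members distinguish \<open>x\<close> from \<open>y\<close>, so there
  is a largest one, and it decides.\<close>

lemma lex_linear:
  assumes "x \<epsilon> X" "y \<epsilon> X"
  shows "(\<forall>a. a \<epsilon> union_of r \<longrightarrow> (cov x a \<longleftrightarrow> cov y a)) \<or> lex r x y \<or> lex r y x"
proof (cases "\<exists>a. a \<epsilon> union_of r \<and> (cov x a \<longleftrightarrow> \<not> cov y a)")
  case True
  then obtain a where a: "a \<epsilon> union_of r" "cov x a \<longleftrightarrow> \<not> cov y a" by blast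
  let ?d = "collect (\<lambda>a. a \<epsilon> union_of r \<and> (cov x a \<longleftrightarrow> \<not> cov y a))"
  have d: "a \<epsilon> ?d \<longleftrightarrow> a \<epsilon> union_of r \<and> (cov x a \<longleftrightarrow> \<not> cov y a)" for a
    by (rule mem_collect_bounded[where a = "union_of r"])
      (blast | rule definable definable_term_shift)+
  obtain s t where s: "is_finite s" "\<And>S. cov x S \<Longrightarrow> S \<epsilon> s"
    and t: "is_finite t" "\<And>S. cov y S \<Longrightarrow> S \<epsilon> t"
    using cov_finite assms by metis
  have "is_finite ?d"
  proof (rule finite_subset_in)
    show "is_finite (union2 s t)" using finite_union2 s t by blast
    show "is_subset ?d (union2 s t)"
      unfolding is_subset_def d mem_union2 using s t by blast
  qed
  moreover have "a \<epsilon> ?d" using a d by blast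
  moreover have "definable (\<lambda>v. before (v 0) (v 1))"
    by (rule definable_term_var1 definable)+
  ultimately have "\<exists>m. m \<epsilon> ?d \<and> (\<forall>b. b \<epsilon> ?d \<longrightarrow> b = m \<or> before b m)"
  proof (rule finite_has_max)
    show "before b c \<Longrightarrow> before c e \<Longrightarrow> before b e" for b c e by (rule before_trans)
    show "b \<epsilon> ?d \<Longrightarrow> c \<epsilon> ?d \<Longrightarrow> b = c \<or> before b c \<or> before c b" for b c
      using linear d by blast
  qed
  then obtain m where m: "m \<epsilon> ?d" "\<And>b. b \<epsilon> ?d \<Longrightarrow> b = m \<or> before b m" by blast
  have above: "cov x b \<longleftrightarrow> cov y b" if "b \<epsilon> union_of r" "before m b" for b
    using m(2)[of b] that d before_asym before_irrefl by blast
  have "m \<epsilon> union_of r" "cov x m \<longleftrightarrow> \<not> cov y m" using m(1) d by blast+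
  then show ?thesis
    unfolding lex_def using above by (cases "cov x m") blast+
qed blast

text \<open>The elements of \<open>Q\<close> agree outside the initial segment \<open>J\<close>. Unless some of them covers nothing in
  \<open>J\<close>, restrict to those whose largest element in \<open>J\<close> is smallest.\<close>

lemma lex_least_step:
  assumes J: "is_subset J (union_of r)"
    and IH: "\<And>a Q q. a \<epsilon> J \<Longrightarrow> q \<epsilon> Q \<Longrightarrow> is_subset Q X \<Longrightarrow>
      (\<And>x y b. x \<epsilon> Q \<Longrightarrow> y \<epsilon> Q \<Longrightarrow> b \<epsilon> union_of r \<Longrightarrow> \<not> before b a \<Longrightarrow> cov x b \<longleftrightarrow> cov y b) \<Longrightarrow>
      \<exists>m. m \<epsilon> Q \<and> (\<forall>y. y \<epsilon> Q \<longrightarrow> \<not> lex r y m)"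
    and Q: "q \<epsilon> Q" "is_subset Q X"
    and agree: "\<And>x y b. x \<epsilon> Q \<Longrightarrow> y \<epsilon> Q \<Longrightarrow> b \<epsilon> union_of r \<Longrightarrow> \<not> b \<epsilon> J \<Longrightarrow> cov x b \<longleftrightarrow> cov y b"
  shows "\<exists>m. m \<epsilon> Q \<and> (\<forall>y. y \<epsilon> Q \<longrightarrow> \<not> lex r y m)"
proof (cases "\<exists>x. x \<epsilon> Q \<and> (\<forall>b. b \<epsilon> J \<longrightarrow> \<not> cov x b)")
  case True
  then obtain x where x: "x \<epsilon> Q" "\<And>b. b \<epsilon> J \<Longrightarrow> \<not> cov x b" by blast
  have "\<not> lex r y x" if "y \<epsilon> Q" for y
    using that x agree unfolding lex_def by blast
  then show ?thesis using x by blast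
next
  case False
  define top where "top x a \<longleftrightarrow> a \<epsilon> J \<and> cov x a \<and> (\<forall>b. b \<epsilon> J \<longrightarrow> cov x b \<longrightarrow> b = a \<or> before b a)"
    for x a
  have top: "\<exists>a. top x a" if x: "x \<epsilon> Q" for x
  proof -
    obtain b where b: "b \<epsilon> J" "cov x b" using False x by blast
    let ?d = "collect (\<lambda>a. a \<epsilon> J \<and> cov x a)"
    have d: "a \<epsilon> ?d \<longleftrightarrow> a \<epsilon> J \<and> cov x a" for a
      by (rule mem_collect_bounded[where a = J]) (blast | rule definable definable_term_shift)+
    obtain s where s: "is_finite s" "\<And>S. cov x S \<Longrightarrow> S \<epsilon> s"
      using cov_finite x Q(2) unfolding is_subset_def by metis
    have "is_finite ?d"
      by (rule finite_subset_in[OF s(1)]) (use s(2) d in \<open>simp add: is_subset_def\<close>)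
    moreover have "b \<epsilon> ?d" using b d by blast
    moreover have "definable (\<lambda>v. before (v 0) (v 1))"
      by (rule definable_term_var1 definable)+
    ultimately have "\<exists>m. m \<epsilon> ?d \<and> (\<forall>b. b \<epsilon> ?d \<longrightarrow> b = m \<or> before b m)"
    proof (rule finite_has_max)
      show "before b c \<Longrightarrow> before c e \<Longrightarrow> before b e" for b c e by (rule before_trans)
      show "b \<epsilon> ?d \<Longrightarrow> c \<epsilon> ?d \<Longrightarrow> b = c \<or> before b c \<or> before c b" for b c
        using linear J d unfolding is_subset_def by blast
    qed
    then show ?thesis unfolding top_def using d by blast
  qed
  have definable_top: "definable_term f \<Longrightarrow> definable_term g \<Longrightarrow> definable (\<lambda>v. top (f v) (g v))"
    for f g
    unfolding top_def by (assumption | rule definable definable_term_shift)+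
  let ?T = "collect (\<lambda>a. a \<epsilon> J \<and> (\<exists>x. x \<epsilon> Q \<and> top x a))"
  have T: "a \<epsilon> ?T \<longleftrightarrow> a \<epsilon> J \<and> (\<exists>x. x \<epsilon> Q \<and> top x a)" for a
    by (rule mem_collect_bounded[where a = J])
      (blast | rule definable_top definable definable_term_shift)+
  obtain a0 where "top q a0" using top Q(1) by blast
  then have "a0 \<epsilon> ?T" unfolding T using Q(1) by (auto simp: top_def)
  moreover have "is_subset ?T (union_of r)"
    using J unfolding is_subset_def T by blast
  ultimately obtain a where a: "a \<epsilon> ?T" "\<And>b. b \<epsilon> ?T \<Longrightarrow> \<not> before b a"
    using least by blast
  let ?Q = "collect (\<lambda>x. x \<epsilon> Q \<and> top x a)"
  have Q': "x \<epsilon> ?Q \<longleftrightarrow> x \<epsilon> Q \<and> top x a" for x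
    by (rule mem_collect_bounded[where a = Q])
      (blast | rule definable_top definable definable_term_shift)+
  have aJ: "a \<epsilon> J" using a T by blast
  have bound: "b = a \<or> before b a" if "x \<epsilon> ?Q" "b \<epsilon> J" "cov x b" for x b
    using that Q' top_def by blast
  have "\<exists>m. m \<epsilon> ?Q \<and> (\<forall>y. y \<epsilon> ?Q \<longrightarrow> \<not> lex r y m)"
  proof -
    obtain q' where "q' \<epsilon> ?Q" using a(1) T Q' by blast
    then show ?thesis
    proof (rule IH[OF aJ])
      show "is_subset ?Q X" using Q(2) Q' by (simp add: is_subset_def)
    next
      fix x y b
      assume *: "x \<epsilon> ?Q" "y \<epsilon> ?Q" "b \<epsilon> union_of r" "\<not> before b a"
      show "cov x b \<longleftrightarrow> cov y b"
      proof (cases "b \<epsilon> J")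
        case False
        then show ?thesis using agree * Q' by blast
      next
        case True
        have "cov x a" "cov y a" using * Q' top_def by blast+
        then show ?thesis using bound[of x b] bound[of y b] * True by blast
      qed
    qed
  qed
  then obtain m where m: "m \<epsilon> ?Q" "\<And>y. y \<epsilon> ?Q \<Longrightarrow> \<not> lex r y m" by blast
  \<comment> \<open>Such a \<open>y\<close> lies outside \<open>?Q\<close>, so its largest covered
    member \<open>b\<close> in \<open>J\<close> comes after \<open>a\<close>. The deciding member
    \<open>c\<close> is at or before \<open>a\<close>, hence \<open>y\<close> and \<open>m\<close>
    agree at \<open>b\<close>, although \<open>m\<close> covers nothing in \<open>J\<close> beyond
    \<open>a\<close>.\<close>
  have "\<not> lex r y m" if y: "y \<epsilon> Q" for y
  proof
    assume l: "lex r y m"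
    then have "\<not> y \<epsilon> ?Q" using m(2) by blast
    obtain b where b: "top y b" using top y by blast
    have "b \<noteq> a" using \<open>\<not> y \<epsilon> ?Q\<close> y b Q' by blast
    have bJ: "b \<epsilon> J" using b by (simp add: top_def)
    then have "b \<epsilon> ?T" unfolding T using b y by blast
    have "b \<epsilon> union_of r" "a \<epsilon> union_of r"
      using bJ aJ J unfolding is_subset_def by blast+
    then have ab: "before a b"
      using linear[of a b] a(2)[OF \<open>b \<epsilon> ?T\<close>] \<open>b \<noteq> a\<close> by blast
    from l obtain c where c: "c \<epsilon> union_of r" "cov m c" "\<not> cov y c"
      "\<And>d. d \<epsilon> union_of r \<Longrightarrow> before c d \<Longrightarrow> cov y d \<longleftrightarrow> cov m d"
      unfolding lex_def by blast
    have mQ: "m \<epsilon> Q" using m(1) Q' by blast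
    have "c \<epsilon> J" using agree[OF y mQ c(1)] c(2,3) by blast
    then have "c = a \<or> before c a" using bound[OF m(1)] c(2) by blast
    then have "before c b" using ab before_trans[OF _ ab] by blast
    then have "cov m b" using c(4)[OF \<open>b \<epsilon> union_of r\<close>] b by (simp add: top_def)
    then have "b = a \<or> before b a" using bound[OF m(1) bJ] by blast
    then show False using before_asym[OF ab] ab before_irrefl by blast
  qed
  then show ?thesis using m(1) Q' by blast
qed

text \<open>Transfinite induction on \<open>a\<close>, carried out at a least counterexample, with
  the predecessors of \<open>a\<close> as \<open>J\<close>. \<open>P\<close> quantifies over
  \<open>Q\<close> because the step passes to a subset of \<open>Q\<close>.\<close>

lemma lex_least_below:
  assumes "a \<epsilon> union_of r"
    and "q \<epsilon> Q" "is_subset Q X"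
    and "\<And>x y b. x \<epsilon> Q \<Longrightarrow> y \<epsilon> Q \<Longrightarrow> b \<epsilon> union_of r \<Longrightarrow> \<not> before b a \<Longrightarrow> cov x b \<longleftrightarrow> cov y b"
  shows "\<exists>m. m \<epsilon> Q \<and> (\<forall>y. y \<epsilon> Q \<longrightarrow> \<not> lex r y m)"
proof -
  define P where "P a \<longleftrightarrow> (\<forall>Q. is_subset Q X \<and> (\<exists>q. q \<epsilon> Q) \<and>
      (\<forall>x y b. x \<epsilon> Q \<and> y \<epsilon> Q \<and> b \<epsilon> union_of r \<and> \<not> before b a \<longrightarrow> (cov x b \<longleftrightarrow> cov y b)) \<longrightarrow>
      (\<exists>m. m \<epsilon> Q \<and> (\<forall>y. y \<epsilon> Q \<longrightarrow> \<not> lex r y m)))" for a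
  let ?B = "collect (\<lambda>a. a \<epsilon> union_of r \<and> \<not> P a)"
  have B: "a \<epsilon> ?B \<longleftrightarrow> a \<epsilon> union_of r \<and> \<not> P a" for a
  proof (rule mem_collect_bounded[where a = "union_of r"])
    show "definable (\<lambda>v. v 0 \<epsilon> union_of r \<and> \<not> P (v 0))"
      unfolding P_def by (rule definable definable_term_shift)+
  qed blast
  have "P a"
  proof (rule ccontr)
    assume *: "\<not> P a"
    have "a \<epsilon> ?B" using * assms(1) B by blast
    moreover have "is_subset ?B (union_of r)" unfolding is_subset_def B by blast
    ultimately obtain a where a: "a \<epsilon> ?B" "\<And>b. b \<epsilon> ?B \<Longrightarrow> \<not> before b a"
      using least by blast
    let ?J = "collect (\<lambda>b. b \<epsilon> union_of r \<and> before b a)"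
    have J: "b \<epsilon> ?J \<longleftrightarrow> b \<epsilon> union_of r \<and> before b a" for b
      by (rule mem_collect_bounded[where a = "union_of r"])
        (blast | rule definable definable_term_shift)+
    have below: "P b" if "b \<epsilon> ?J" for b
      using that a J B by blast
    have "P a"
      unfolding P_def
    proof (intro allI impI, elim conjE exE)
      fix Q q
      assume Q: "is_subset Q X" "q \<epsilon> Q"
        "\<forall>x y b. x \<epsilon> Q \<and> y \<epsilon> Q \<and> b \<epsilon> union_of r \<and> \<not> before b a \<longrightarrow> (cov x b \<longleftrightarrow> cov y b)"
      show "\<exists>m. m \<epsilon> Q \<and> (\<forall>y. y \<epsilon> Q \<longrightarrow> \<not> lex r y m)"
      proof (rule lex_least_step[OF _ _ Q(2,1)])
        show "is_subset ?J (union_of r)" unfolding is_subset_def J by blast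
      next
        fix b Q' q'
        assume "b \<epsilon> ?J" "q' \<epsilon> Q'" "is_subset Q' X"
          "\<And>x y c. x \<epsilon> Q' \<Longrightarrow> y \<epsilon> Q' \<Longrightarrow> c \<epsilon> union_of r \<Longrightarrow> \<not> before c b \<Longrightarrow> cov x c \<longleftrightarrow> cov y c"
        then show "\<exists>m. m \<epsilon> Q' \<and> (\<forall>y. y \<epsilon> Q' \<longrightarrow> \<not> lex r y m)"
          using below[of b] unfolding P_def by blast
      next
        fix x y b assume "x \<epsilon> Q" "y \<epsilon> Q" "b \<epsilon> union_of r" "\<not> b \<epsilon> ?J"
        then show "cov x b \<longleftrightarrow> cov y b" using Q(3) J by blast
      qed
    qed
    then show False using a(1) B by blast
  qed
  then show ?thesis
    using assms(2-4) unfolding P_def by blast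
qed

text \<open>One further step, with the whole family as \<open>J\<close>: it need not be the set of
  predecessors of a member.\<close>

lemma lex_least:
  assumes "q \<epsilon> Q" "is_subset Q X"
  shows "\<exists>m. m \<epsilon> Q \<and> (\<forall>y. y \<epsilon> Q \<longrightarrow> \<not> lex r y m)"
proof (rule lex_least_step[OF _ _ assms])
  show "is_subset (union_of r) (union_of r)" by (simp add: is_subset_def)
next
  fix a Q' q'
  assume "a \<epsilon> union_of r" "q' \<epsilon> Q'" "is_subset Q' X"
    "\<And>x y b. x \<epsilon> Q' \<Longrightarrow> y \<epsilon> Q' \<Longrightarrow> b \<epsilon> union_of r \<Longrightarrow> \<not> before b a \<Longrightarrow> cov x b \<longleftrightarrow> cov y b"
  then show "\<exists>m. m \<epsilon> Q' \<and> (\<forall>y. y \<epsilon> Q' \<longrightarrow> \<not> lex r y m)"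
    by (rule lex_least_below)
qed blast

section \<open>The canonical prewellordering of the points\<close>

lemma less_irrefl: "\<not> less r x x"
  unfolding less_def using lex_irrefl by blast

lemma less_trans:
  assumes "less r x y" "less r y z"
  shows "less r x z"
proof -
  have "bounds x = bounds y" if "same_bounds x y" for x y
    using that by (auto simp: same_bounds_def)
  note eq = this
  from assms(1) consider n where "bounds x n" "\<not> bounds y n" | "same_bounds x y" "lex r x y"
    unfolding less_def by blast
  then show ?thesis
  proof cases
    case (1 n)
    then have "\<not> bounds z n"
      using assms(2) bounds_strict_asym[of y _ z n] eq[of y z] unfolding less_def by auto
    then show ?thesis using 1 unfolding less_def by blast
  next
    case 2
    then show ?thesis
      using assms(2) lex_trans[OF 2(2)] eq[OF 2(1)] unfolding less_def same_bounds_def by auto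
  qed
qed

lemma less_linear:
  assumes "x \<epsilon> X" "y \<epsilon> X"
  shows "similar r x y \<or> less r x y \<or> less r y x"
  using bounds_linear[of x y] lex_linear[OF assms]
  unfolding similar_def less_def same_bounds_def by blast

lemma less_similar:
  assumes "similar r x y"
  shows "less r x z \<longleftrightarrow> less r y z" "less r z x \<longleftrightarrow> less r z y"
proof -
  have b: "bounds x = bounds y" using assms unfolding similar_def same_bounds_def by blast
  have c: "cov x a \<longleftrightarrow> cov y a" if "a \<epsilon> union_of r" for a
    using assms that unfolding similar_def by blast
  have "lex r x z \<longleftrightarrow> lex r y z" "lex r z x \<longleftrightarrow> lex r z y"
    unfolding lex_def using c by blast+
  then show "less r x z \<longleftrightarrow> less r y z" "less r z x \<longleftrightarrow> less r z y"
    unfolding less_def same_bounds_def b by blast+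
qed

lemma less_least:
  assumes "q \<epsilon> Q" "is_subset Q X"
  shows "\<exists>m. m \<epsilon> Q \<and> (\<forall>y. y \<epsilon> Q \<longrightarrow> \<not> less r y m)"
proof -
  obtain n0 where "bounds q n0"
    using bounds_exists assms unfolding is_subset_def by blast
  then have "is_natural n0" "\<exists>x. x \<epsilon> Q \<and> bounds x n0"
    using assms(1) by (auto simp: bounds_def)
  moreover have "definable (\<lambda>v. \<exists>x. x \<epsilon> Q \<and> bounds x (v 0))"
    by (rule definable definable_term_shift)+
  ultimately have "\<exists>n. is_natural n \<and> (\<exists>x. x \<epsilon> Q \<and> bounds x n) \<and>
    (\<forall>k. is_natural k \<and> (\<exists>x. x \<epsilon> Q \<and> bounds x k) \<longrightarrow> \<not> k \<epsilon> n)"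
    by (intro natural_least)
  then obtain n where n: "\<exists>x. x \<epsilon> Q \<and> bounds x n"
    "\<And>k. is_natural k \<Longrightarrow> \<exists>x. x \<epsilon> Q \<and> bounds x k \<Longrightarrow> \<not> k \<epsilon> n"
    by blast
  \<comment> \<open>Minimality of \<open>n\<close> fixes all bounds of the elements of
    \<open>Q\<close> that are bounded by \<open>n\<close>, so among these only \<open>lex\<close>
    decides.\<close>
  have eq: "bounds x k \<longleftrightarrow> is_natural k \<and> (k = n \<or> n \<epsilon> k)" if x: "x \<epsilon> Q" "bounds x n" for x k
  proof
    assume k: "bounds x k"
    then have "is_natural k" "is_natural n" using x by (simp_all add: bounds_def)
    moreover have "\<not> k \<epsilon> n" using n(2)[OF \<open>is_natural k\<close>] k x(1) by blast
    ultimately show "is_natural k \<and> (k = n \<or> n \<epsilon> k)"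
      using natural_linear[of k n] by blast
  next
    assume "is_natural k \<and> (k = n \<or> n \<epsilon> k)"
    then show "bounds x k" using bounds_upward[OF x(2), of k] x(2) by blast
  qed
  let ?Q = "collect (\<lambda>x. x \<epsilon> Q \<and> bounds x n)"
  have Q: "x \<epsilon> ?Q \<longleftrightarrow> x \<epsilon> Q \<and> bounds x n" for x
    by (rule mem_collect_bounded[where a = Q]) (blast | rule definable definable_term_shift)+
  obtain p where "p \<epsilon> ?Q" using n(1) Q by blast
  moreover have "is_subset ?Q X" using assms(2) Q by (simp add: is_subset_def)
  ultimately obtain m where m: "m \<epsilon> ?Q" "\<And>y. y \<epsilon> ?Q \<Longrightarrow> \<not> lex r y m"
    using lex_least by blast
  have "\<not> less r y m" if y: "y \<epsilon> Q" for y
  proof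
    assume l: "less r y m"
    have m': "m \<epsilon> Q" "bounds m n" using m(1) Q by blast+
    from l consider k where "bounds y k" "\<not> bounds m k" | "same_bounds y m" "lex r y m"
      unfolding less_def by blast
    then show False
    proof cases
      case 1
      then have "bounds y n" using bounds_strict_asym[OF 1 m'(2)] by blast
      then show False using eq[OF y, of k] eq[OF m', of k] 1 by blast
    next
      case 2
      then have "y \<epsilon> ?Q" using y m'(2) Q unfolding same_bounds_def by blast
      then show False using 2 m(2) by blast
    qed
  qed
  then show ?thesis using m(1) Q by blast
qed

section \<open>Segments as representatives of the classes\<close>

lemma seg_similar: "similar r x y \<Longrightarrow> seg r x = seg r y"
  by (rule set_eqI) (simp add: mem_seg less_similar(2))

lemma seg_less:
  assumes "x \<epsilon> X" "less r x y"
  shows "is_subset (seg r x) (seg r y)" "seg r x \<noteq> seg r y"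
proof -
  show "is_subset (seg r x) (seg r y)"
    using less_trans[OF _ assms(2)] by (simp add: is_subset_def mem_seg)
  have "x \<epsilon> seg r y" "\<not> x \<epsilon> seg r x"
    using assms less_irrefl by (simp_all add: mem_seg)
  then show "seg r x \<noteq> seg r y" by auto
qed

lemma seg_eqD:
  assumes "x \<epsilon> X" "y \<epsilon> X" "seg r x = seg r y"
  shows "similar r x y"
  using less_linear[OF assms(1,2)] seg_less(2)[OF assms(1), of y] seg_less(2)[OF assms(2), of x]
    assms(3) by auto

lemma seg_in_segs: "x \<epsilon> X \<Longrightarrow> seg r x \<epsilon> segs r"
  unfolding mem_segs by blast

lemma segs_chain:
  assumes "c \<epsilon> segs r" "d \<epsilon> segs r"
  shows "is_subset c d \<or> is_subset d c"
proof -
  obtain x y where x: "x \<epsilon> X" "c = seg r x" and y: "y \<epsilon> X" "d = seg r y"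
    using assms unfolding mem_segs by blast
  then show ?thesis
    using less_linear[OF x(1) y(1)] seg_similar[of x y] seg_less(1)[OF x(1), of y]
      seg_less(1)[OF y(1), of x]
    by (auto simp: is_subset_def)
qed

lemma segs_least:
  assumes "q \<epsilon> Q" "is_subset Q (segs r)"
  shows "\<exists>m. m \<epsilon> Q \<and> (\<forall>c. c \<epsilon> Q \<longrightarrow> is_subset m c)"
proof -
  let ?Y = "collect (\<lambda>x. x \<epsilon> X \<and> seg r x \<epsilon> Q)"
  have Y: "x \<epsilon> ?Y \<longleftrightarrow> x \<epsilon> X \<and> seg r x \<epsilon> Q" for x
    by (rule mem_collect_bounded[where a = X]) (blast | rule definable definable_term_shift)+
  have repr: "\<exists>x. x \<epsilon> ?Y \<and> c = seg r x" if "c \<epsilon> Q" for c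
    using that assms(2) unfolding is_subset_def mem_segs Y by blast
  obtain x0 where "x0 \<epsilon> ?Y" using repr[OF assms(1)] by blast
  moreover have "is_subset ?Y X" unfolding is_subset_def Y by blast
  ultimately obtain m where m: "m \<epsilon> ?Y" "\<And>y. y \<epsilon> ?Y \<Longrightarrow> \<not> less r y m"
    using less_least by blast
  have "is_subset (seg r m) c" if c: "c \<epsilon> Q" for c
  proof -
    obtain y where y: "y \<epsilon> ?Y" "c = seg r y" using repr[OF c] by blast
    have "m \<epsilon> X" "y \<epsilon> X" using m(1) y(1) Y by blast+
    then have "similar r m y \<or> less r m y" using less_linear m(2)[OF y(1)] by blast
    then show ?thesis
      using seg_similar[of m y] seg_less(1)[OF \<open>m \<epsilon> X\<close>, of y] y(2) by (auto simp: is_subset_def)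
  qed
  then show ?thesis using m(1) Y by blast
qed

text \<open>There is no last segment because every bound is exceeded by the cardinality of some set.\<close>

lemma segs_no_max:
  assumes "c \<epsilon> segs r"
  shows "\<exists>d. d \<epsilon> segs r \<and> is_subset c d \<and> d \<noteq> c"
proof -
  obtain x where x: "x \<epsilon> X" "c = seg r x" using assms unfolding mem_segs by blast
  obtain y n where y: "y \<epsilon> X" "bounds x n" "\<not> bounds y n" using bounds_no_max[OF x(1)] by blast
  then have "less r x y" unfolding less_def by blast
  then show ?thesis
    using seg_less[OF x(1), of y] seg_in_segs[OF y(1)] x(2) by metis
qed

text \<open>Successors keep a block going: each lies in the block of its predecessor, so no block
  ends after finitely many classes.\<close>

lemma segs_successor:
  assumes "c \<epsilon> segs r"
  obtains d where "d \<epsilon> segs r" "is_subset c d" "d \<noteq> c"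
    "\<And>e. e \<epsilon> segs r \<Longrightarrow> is_subset c e \<Longrightarrow> e \<noteq> c \<Longrightarrow> is_subset d e"
proof -
  let ?Q = "collect (\<lambda>d. d \<epsilon> segs r \<and> is_subset c d \<and> d \<noteq> c)"
  have Q: "d \<epsilon> ?Q \<longleftrightarrow> d \<epsilon> segs r \<and> is_subset c d \<and> d \<noteq> c" for d
    by (rule mem_collect_bounded[where a = "segs r"]) (blast | rule definable definable_term_shift)+
  obtain d0 where "d0 \<epsilon> ?Q" using segs_no_max[OF assms] Q by blast
  moreover have "is_subset ?Q (segs r)" by (rule subsetI) (use Q in blast)
  ultimately obtain d where "d \<epsilon> ?Q" "\<And>e. e \<epsilon> ?Q \<Longrightarrow> is_subset d e"
    using segs_least by blast
  then show thesis using that Q by blast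
qed

text \<open>The intersection is attained at a \<open>less\<close>-minimal point among those that
  cover \<open>a\<close>.\<close>

lemma first_seg_eq:
  assumes "a \<epsilon> union_of r"
  obtains x where "x \<epsilon> X" "cov x a" "first_seg r a = seg r x"
proof -
  let ?Q = "collect (\<lambda>x. x \<epsilon> X \<and> cov x a)"
  have Q: "x \<epsilon> ?Q \<longleftrightarrow> x \<epsilon> X \<and> cov x a" for x
    by (rule mem_collect_bounded[where a = X]) (blast | rule definable definable_term_shift)+
  obtain x0 where "x0 \<epsilon> ?Q" using covered[OF assms] Q by blast
  moreover have "is_subset ?Q X" unfolding is_subset_def Q by blast
  ultimately obtain m where m: "m \<epsilon> ?Q" "\<And>y. y \<epsilon> ?Q \<Longrightarrow> \<not> less r y m"
    using less_least by blast
  have mX: "m \<epsilon> X" "cov m a" using m(1) Q by blast+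
  have "first_seg r a = seg r m"
  proof (rule set_eqI)
    fix z
    have "less r z x" if "less r z m" "x \<epsilon> X" "cov x a" for x
    proof -
      have "\<not> less r x m" using m(2) Q that by blast
      then have "similar r m x \<or> less r m x" using less_linear[OF mX(1) that(2)] by blast
      then show ?thesis using less_trans[OF that(1), of x] less_similar(2)[of m x z] that(1) by blast
    qed
    then show "z \<epsilon> first_seg r a \<longleftrightarrow> z \<epsilon> seg r m"
      unfolding mem_first_seg mem_seg using mX by blast
  qed
  then show thesis using that mX by blast
qed

lemma first_seg_in_segs: "a \<epsilon> union_of r \<Longrightarrow> first_seg r a \<epsilon> segs r"
  using first_seg_eq seg_in_segs by metis

section \<open>Blocks of type omega\<close>

lemma near_refl: "near r c c"
proof -
  have "between r c c = emp"
    by (rule set_eqI) (use subset_antisym in \<open>auto simp: mem_between\<close>)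
  then show ?thesis by (simp add: near_def finite_emp)
qed

lemma near_sym: "near r c d \<Longrightarrow> near r d c"
  unfolding near_def by blast

text \<open>The position of \<open>d\<close> does not matter: a segment in the interval from
  \<open>c\<close> to \<open>e\<close> either contains \<open>d\<close> or is properly contained in
  it.\<close>

lemma finite_between_trans:
  assumes "d \<epsilon> segs r" "is_finite (between r c d)" "is_finite (between r d e)"
  shows "is_finite (between r c e)"
proof (rule finite_subset_in[OF finite_union2[OF assms(2,3)]])
  have "x \<epsilon> between r c d \<or> x \<epsilon> between r d e" if x: "x \<epsilon> between r c e" for x
  proof -
    have x': "x \<epsilon> segs r" "is_subset c x" "is_subset x e" "x \<noteq> e"
      using x by (simp_all add: mem_between)
    show ?thesis
    proof (cases "is_subset d x")
      case False
      then have "is_subset x d" "x \<noteq> d"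
        using segs_chain[OF x'(1) assms(1)] by (auto simp: is_subset_def)
      then show ?thesis using x' by (simp add: mem_between)
    qed (use x' in \<open>simp add: mem_between\<close>)
  qed
  then show "is_subset (between r c e) (union2 (between r c d) (between r d e))"
    unfolding is_subset_def by simp
qed

lemma near_trans:
  assumes "d \<epsilon> segs r" "near r c d" "near r d e"
  shows "near r c e"
  using assms finite_between_trans unfolding near_def by metis

lemma block_least:
  assumes "c \<epsilon> segs r"
  obtains l where "l \<epsilon> segs r" "near r l c"
    "\<And>d. d \<epsilon> segs r \<Longrightarrow> near r d c \<Longrightarrow> is_subset l d"
proof -
  let ?Q = "collect (\<lambda>d. d \<epsilon> segs r \<and> near r d c)"
  have Q: "d \<epsilon> ?Q \<longleftrightarrow> d \<epsilon> segs r \<and> near r d c" for d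
    by (rule mem_collect_bounded[where a = "segs r"]) (blast | rule definable definable_term_shift)+
  have "c \<epsilon> ?Q" using assms near_refl Q by blast
  moreover have "is_subset ?Q (segs r)" unfolding is_subset_def Q by blast
  ultimately obtain l where "l \<epsilon> ?Q" "\<And>d. d \<epsilon> ?Q \<Longrightarrow> is_subset l d"
    using segs_least by blast
  then show thesis using that Q by blast
qed

text \<open>The predecessors lie between the least segment of the block and \<open>c\<close>, and
  \<open>near\<close> makes that interval finite.\<close>

lemma finite_preds:
  assumes "c \<epsilon> segs r"
  shows "is_finite (preds r c)"
proof -
  obtain l where l: "l \<epsilon> segs r" "near r l c" "\<And>d. d \<epsilon> segs r \<Longrightarrow> near r d c \<Longrightarrow> is_subset l d"
    using block_least[OF assms] by blast
  have "is_finite (between r l c)" using l(2) by (simp add: near_def)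
  moreover have "is_subset (preds r c) (between r l c)"
    using l(3) by (simp add: is_subset_def mem_preds mem_between)
  ultimately show ?thesis by (rule finite_subset_in)
qed

text \<open>Every earlier member is covered by one of the finitely many classes of the block up to
  the first class of \<open>a\<close>, and each class covers finitely many members.\<close>

lemma finite_earlier:
  assumes "a \<epsilon> union_of r"
  shows "is_finite (earlier r a)"
proof -
  \<comment> \<open>A class, named by its segment, may have infinitely many points, but they all
    cover the same members of the family; the finite bound for one representative serves for the
    class.\<close>
  define R where "R c b \<longleftrightarrow> b \<epsilon> union_of r \<and> (\<exists>x. x \<epsilon> X \<and> c = seg r x \<and> cov x b)" for c b
  let ?s = "insert_in (first_seg r a) (preds r (first_seg r a))"
  have "is_finite ?s"
    using finite_insert[OF finite_preds[OF first_seg_in_segs[OF assms]]] .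
  moreover have "definable (\<lambda>v. R (v 0) (v 1))"
    unfolding R_def by (rule definable_term_var1 definable definable_term_shift)+
  ultimately have "\<exists>t. is_finite t \<and> (\<forall>c b. c \<epsilon> ?s \<and> R c b \<longrightarrow> b \<epsilon> t)"
  proof (rule finite_UN)
    fix c assume "c \<epsilon> ?s"
    then have "c \<epsilon> segs r"
      using first_seg_in_segs[OF assms] by (auto simp: mem_preds)
    then obtain x where x: "x \<epsilon> X" "c = seg r x" unfolding mem_segs by blast
    obtain t where t: "is_finite t" "\<And>S. cov x S \<Longrightarrow> S \<epsilon> t" using cov_finite[OF x(1)] by blast
    have "b \<epsilon> t" if R: "R c b" for b
    proof -
      obtain y where y: "b \<epsilon> union_of r" "y \<epsilon> X" "c = seg r y" "cov y b"
        using R unfolding R_def by blast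
      have "similar r x y" using seg_eqD[OF x(1) y(2)] x(2) y(3) by simp
      then have "cov x b" using y(1,4) unfolding similar_def by blast
      then show ?thesis by (rule t(2))
    qed
    then show "\<exists>t. is_finite t \<and> (\<forall>b. R c b \<longrightarrow> b \<epsilon> t)" using t(1) by blast
  qed
  then obtain t where t: "is_finite t" "\<And>c b. c \<epsilon> ?s \<Longrightarrow> R c b \<Longrightarrow> b \<epsilon> t" by blast
  have "b \<epsilon> t" if b: "b \<epsilon> earlier r a" for b
  proof -
    have bW: "b \<epsilon> union_of r" using b unfolding mem_earlier by blast
    have "first_seg r b \<epsilon> ?s"
      using b first_seg_in_segs[OF bW] unfolding mem_earlier mem_insert_in mem_preds by blast
    moreover have "R (first_seg r b) b"
      using first_seg_eq[OF bW] bW unfolding R_def by metis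
    ultimately show ?thesis by (rule t(2))
  qed
  then show ?thesis
    by (intro finite_subset_in[OF t(1)]) (simp add: is_subset_def)
qed

section \<open>Matching classes with members by position\<close>

lemma not_earlier_self: "\<not> a \<epsilon> earlier r a"
  unfolding mem_earlier using before_irrefl by blast

lemma earlier_linear:
  assumes "a \<epsilon> union_of r" "b \<epsilon> union_of r" "near r (first_seg r a) (first_seg r b)"
  shows "a = b \<or> a \<epsilon> earlier r b \<or> b \<epsilon> earlier r a"
proof (cases "first_seg r a = first_seg r b")
  case True
  then show ?thesis
    using linear[OF assms(1,2)] assms near_sym unfolding mem_earlier by auto
next
  case False
  then show ?thesis
    using segs_chain[OF first_seg_in_segs[OF assms(1)] first_seg_in_segs[OF assms(2)]]
      assms near_sym[OF assms(3)] unfolding mem_earlier by auto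
qed

lemma earlier_trans:
  assumes "a \<epsilon> union_of r" "b \<epsilon> earlier r a" "c \<epsilon> earlier r b"
  shows "c \<epsilon> earlier r a"
proof -
  let ?f = "first_seg r"
  have b: "b \<epsilon> union_of r" "near r (?f b) (?f a)"
    "is_subset (?f b) (?f a) \<and> ?f b \<noteq> ?f a \<or> ?f b = ?f a \<and> before b a"
    using assms(2) unfolding mem_earlier by blast+
  have c: "c \<epsilon> union_of r" "near r (?f c) (?f b)"
    "is_subset (?f c) (?f b) \<and> ?f c \<noteq> ?f b \<or> ?f c = ?f b \<and> before c b"
    using assms(3) unfolding mem_earlier by blast+
  have "near r (?f c) (?f a)"
    using near_trans[OF first_seg_in_segs[OF b(1)] c(2) b(2)] .
  moreover have "is_subset (?f c) (?f a) \<and> ?f c \<noteq> ?f a \<or> ?f c = ?f a \<and> before c a"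
  proof (cases "?f b = ?f a \<or> ?f c = ?f b")
    case True
    then show ?thesis using b(3) c(3) before_trans[of c b a] by auto
  next
    case False
    then have *: "is_subset (?f b) (?f a)" "is_subset (?f c) (?f b)" "?f b \<noteq> ?f a"
      using b(3) c(3) by blast+
    then have "is_subset (?f c) (?f a)" by (simp add: is_subset_def)
    moreover have "?f c \<noteq> ?f a" using subset_antisym[OF *(1)] * by auto
    ultimately show ?thesis by blast
  qed
  ultimately show ?thesis unfolding mem_earlier using c(1) by blast
qed

lemma earlier_subset:
  assumes "a \<epsilon> union_of r" "b \<epsilon> earlier r a"
  shows "is_subset (earlier r b) (earlier r a)"
  unfolding is_subset_def using earlier_trans[OF assms] by blast

text \<open>Two matches of \<open>x\<close> lie in one block at the same position. If one were
  earlier than the other, a set of earlier members would be a proper subset of another of the same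
  finite cardinality.\<close>

lemma matches_functional:
  assumes "x \<epsilon> X" "matches r x a" "matches r x b"
  shows "a = b"
proof -
  obtain n where a: "a \<epsilon> union_of r" "near r (seg r x) (first_seg r a)"
      "has_card (earlier r a) n" "has_card (preds r (seg r x)) n"
    using assms(2) unfolding matches_def by (elim conjE exE)
  obtain m where b: "b \<epsilon> union_of r" "near r (seg r x) (first_seg r b)"
      "has_card (earlier r b) m" "has_card (preds r (seg r x)) m"
    using assms(3) unfolding matches_def by (elim conjE exE)
  have "m = n" using has_card_unique[OF a(4) b(4)] .
  have "near r (first_seg r a) (first_seg r b)"
    using near_trans[OF seg_in_segs[OF assms(1)] near_sym[OF a(2)] b(2)] .
  then consider "a = b" | "a \<epsilon> earlier r b" | "b \<epsilon> earlier r a"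
    using earlier_linear[OF a(1) b(1)] by blast
  then show ?thesis
  proof cases
    case 2
    then have "earlier r a = earlier r b"
      using has_card_subset_eq[OF a(3) b(3)[unfolded \<open>m = n\<close>] earlier_subset[OF b(1) 2]] by blast
    then show ?thesis using 2 not_earlier_self[of a] by simp
  next
    case 3
    then have "earlier r b = earlier r a"
      using has_card_subset_eq[OF b(3)[unfolded \<open>m = n\<close>] a(3) earlier_subset[OF a(1) 3]] by blast
    then show ?thesis using 3 not_earlier_self[of b] by simp
  qed
qed

text \<open>Every position in a block is occupied: the least class has position zero, and the
  successor of a class has the next position.\<close>

lemma preds_card:
  assumes "c0 \<epsilon> segs r" "is_natural n"
  shows "\<exists>c. c \<epsilon> segs r \<and> near r c c0 \<and> has_card (preds r c) n"
  using assms(2)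
proof (rule natural_induct)
  show "definable (\<lambda>v. \<exists>c. c \<epsilon> segs r \<and> near r c c0 \<and> has_card (preds r c) (v 0))"
    by (rule definable definable_term_shift)+
next
  obtain l where l: "l \<epsilon> segs r" "near r l c0" "\<And>d. d \<epsilon> segs r \<Longrightarrow> near r d c0 \<Longrightarrow> is_subset l d"
    using block_least[OF assms(1)] by blast
  have "\<not> d \<epsilon> preds r l" for d
  proof
    assume "d \<epsilon> preds r l"
    then have d: "d \<epsilon> segs r" "is_subset d l" "d \<noteq> l" "near r d l"
      unfolding mem_preds by blast+
    have "is_subset l d" using l(3)[OF d(1) near_trans[OF l(1) d(4) l(2)]] .
    then show False using subset_antisym[OF d(2)] d(3) by blast
  qed
  then have "preds r l = emp" by (intro set_eqI) simp
  then show "\<exists>c. c \<epsilon> segs r \<and> near r c c0 \<and> has_card (preds r c) emp"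
    using l has_card_zero by metis
next
  fix n assume n: "is_natural n" and "\<exists>c. c \<epsilon> segs r \<and> near r c c0 \<and> has_card (preds r c) n"
  then obtain c where c: "c \<epsilon> segs r" "near r c c0" "has_card (preds r c) n" by blast
  obtain d where d: "d \<epsilon> segs r" "is_subset c d" "d \<noteq> c"
    "\<And>e. e \<epsilon> segs r \<Longrightarrow> is_subset c e \<Longrightarrow> e \<noteq> c \<Longrightarrow> is_subset d e"
    using segs_successor[OF c(1)] by blast
  \<comment> \<open>Between \<open>c\<close> and its successor there is only \<open>c\<close>
    itself, so \<open>d\<close> remains in the block.\<close>
  have "is_subset (between r c d) (insert_in c emp)"
    unfolding is_subset_def
  proof (intro allI impI)
    fix e assume "e \<epsilon> between r c d"
    then have "e \<epsilon> segs r" "is_subset c e" "is_subset e d" "e \<noteq> d"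
      unfolding mem_between by blast+
    then have "e = c" using d(4) subset_antisym by blast
    then show "e \<epsilon> insert_in c emp" by simp
  qed
  then have "is_finite (between r c d)"
    using finite_subset_in[OF finite_insert[OF finite_emp]] by blast
  moreover have "between r d c = emp"
  proof (rule set_eqI)
    fix e
    have "\<not> e \<epsilon> between r d c"
    proof
      assume "e \<epsilon> between r d c"
      then have "is_subset d e" "is_subset e c" "e \<noteq> c" unfolding mem_between by blast+
      then have "is_subset c e" using d(2) by (simp add: is_subset_def)
      then show False using subset_antisym[OF \<open>is_subset e c\<close>] \<open>e \<noteq> c\<close> by blast
    qed
    then show "e \<epsilon> between r d c \<longleftrightarrow> e \<epsilon> emp" by simp
  qed
  ultimately have near: "near r c d" using finite_emp unfolding near_def by simp
  have "preds r d = insert_in c (preds r c)"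
  proof (rule set_eqI)
    fix e
    show "e \<epsilon> preds r d \<longleftrightarrow> e \<epsilon> insert_in c (preds r c)"
    proof
      assume "e \<epsilon> preds r d"
      then have e: "e \<epsilon> segs r" "is_subset e d" "e \<noteq> d" "near r e d"
        unfolding mem_preds by blast+
      show "e \<epsilon> insert_in c (preds r c)"
      proof (cases "e = c")
        case False
        then have "\<not> is_subset c e" using d(4)[OF e(1)] e subset_antisym by blast
        then have "is_subset e c" using segs_chain[OF e(1) c(1)] by blast
        moreover have "near r e c" using near_trans[OF d(1) e(4) near_sym[OF near]] .
        ultimately show ?thesis using e(1) False by (simp add: mem_preds)
      qed simp
    next
      assume "e \<epsilon> insert_in c (preds r c)"
      then consider "e = c" | "e \<epsilon> preds r c" by auto
      then show "e \<epsilon> preds r d"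
      proof cases
        case 1
        then show ?thesis using c(1) d near by (simp add: mem_preds)
      next
        case 2
        then have e: "e \<epsilon> segs r" "is_subset e c" "e \<noteq> c" "near r e c"
          unfolding mem_preds by blast+
        have "near r e d" using near_trans[OF c(1) e(4) near] .
        moreover have "is_subset e d" using e(2) d(2) by (simp add: is_subset_def)
        moreover have "e \<noteq> d" using subset_antisym[OF e(2)] d(2) e(3) by blast
        ultimately show ?thesis using e(1) by (simp add: mem_preds)
      qed
    qed
  qed
  moreover have "\<not> c \<epsilon> preds r c" by (simp add: mem_preds)
  ultimately have "has_card (preds r d) (insert_in n n)"
    using has_card_insert[OF c(3)] by simp
  moreover have "near r d c0" using near_trans[OF c(1) near_sym[OF near] c(2)] .
  ultimately show "\<exists>c. c \<epsilon> segs r \<and> near r c c0 \<and> has_card (preds r c) (insert_in n n)"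
    using d(1) by blast
qed

lemma matches_exists:
  assumes "a \<epsilon> union_of r"
  shows "\<exists>x. x \<epsilon> X \<and> matches r x a"
proof -
  obtain n where n: "has_card (earlier r a) n"
    using finite_earlier[OF assms] is_finite_iff by blast
  obtain c where c: "c \<epsilon> segs r" "near r c (first_seg r a)" "has_card (preds r c) n"
    using preds_card[OF first_seg_in_segs[OF assms] has_card_natural[OF n]] by blast
  then obtain x where x: "x \<epsilon> X" "c = seg r x" unfolding mem_segs by blast
  have "near r (seg r x) (first_seg r a)" "has_card (preds r (seg r x)) n"
    using c(2,3) x(2) by simp_all
  then have "matches r x a"
    unfolding matches_def using assms n by blast
  then show ?thesis using x(1) by blast
qed

text \<open>Cantor's argument at a point matched with the diagonal set; as the match is unique, the
  existential quantifier in \<open>diagonal\<close> can only refer to that set.\<close>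

lemma diagonal_new: "\<not> diagonal r \<epsilon> union_of r"
proof
  assume "diagonal r \<epsilon> union_of r"
  then obtain x where x: "x \<epsilon> X" "matches r x (diagonal r)"
    using matches_exists by blast
  have "(\<exists>a. matches r x a \<and> \<not> x \<epsilon> a) \<longleftrightarrow> \<not> x \<epsilon> diagonal r"
    using matches_functional[OF x(1) x(2)] x(2) by metis
  then show False
    using mem_diagonal[of x r] x(1) by blast
qed

end

context finite_cover
begin

section \<open>Transfinite iteration\<close>

text \<open>As \<open>r\<close> lists initial segments, the next one consists of all members so far
  and the diagonal set as new last member.\<close>

definition next_stage :: "'u \<Rightarrow> 'u" where
  "next_stage r = insert_in (diagonal r) (union_of r)"

definition initial :: "'u \<Rightarrow> 'u \<Rightarrow> 'u" where
  "initial r I = collect (\<lambda>J. J \<epsilon> r \<and> is_subset J I \<and> J \<noteq> I)"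

text \<open>Approximations to the transfinite recursion, in which each segment is determined by
  those before it. Coding the well-ordering by its initial segments makes the order inclusion and
  keeps every approximation inside one power set.\<close>

definition good :: "'u \<Rightarrow> bool" where
  "good r \<longleftrightarrow> is_subset r (pow (pow X)) \<and>
    (\<forall>I J. I \<epsilon> r \<and> J \<epsilon> r \<longrightarrow> is_subset I J \<or> is_subset J I) \<and>
    (\<forall>Q q. q \<epsilon> Q \<and> is_subset Q r \<longrightarrow> (\<exists>m. m \<epsilon> Q \<and> (\<forall>y. y \<epsilon> Q \<longrightarrow> is_subset m y))) \<and>
    (\<forall>I. I \<epsilon> r \<longrightarrow> I = next_stage (initial r I))"

lemma definable_next_stage [definable]:
  "definable_term f \<Longrightarrow> definable_term (\<lambda>v. next_stage (f v))"
  unfolding next_stage_def by (assumption | rule definable definable_term_shift)+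

lemma definable_initial [definable]:
  "definable_term f \<Longrightarrow> definable_term g \<Longrightarrow> definable_term (\<lambda>v. initial (f v) (g v))"
  unfolding initial_def by (assumption | rule definable definable_term_shift)+

lemma definable_good [definable]:
  "definable_term f \<Longrightarrow> definable (\<lambda>v. good (f v))"
  unfolding good_def by (assumption | rule definable definable_term_shift)+

lemma mem_next_stage: "a \<epsilon> next_stage r \<longleftrightarrow> a = diagonal r \<or> a \<epsilon> union_of r"
  by (simp add: next_stage_def)

lemma mem_initial: "J \<epsilon> initial r I \<longleftrightarrow> J \<epsilon> r \<and> is_subset J I \<and> J \<noteq> I"
  unfolding initial_def
  by (rule mem_collect_bounded[where a = r]) (blast | rule definable definable_term_shift)+

lemma good_subset: "good r \<Longrightarrow> is_subset r (pow (pow X))"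
  unfolding good_def by (elim conjE)

lemma good_chain: "good r \<Longrightarrow> I \<epsilon> r \<Longrightarrow> J \<epsilon> r \<Longrightarrow> is_subset I J \<or> is_subset J I"
  unfolding good_def by simp

lemma good_next: "good r \<Longrightarrow> I \<epsilon> r \<Longrightarrow> next_stage (initial r I) = I"
  unfolding good_def by simp

lemma good_least:
  assumes "good r" "q \<epsilon> Q" "is_subset Q r"
  obtains m where "m \<epsilon> Q" "\<And>y. y \<epsilon> Q \<Longrightarrow> is_subset m y"
proof -
  have "\<exists>m. m \<epsilon> Q \<and> (\<forall>y. y \<epsilon> Q \<longrightarrow> is_subset m y)"
    using assms unfolding good_def by blast
  then show thesis using that by blast
qed

lemma good_least_with:
  assumes "good r" "definable (\<lambda>v. P (v 0))" "I \<epsilon> r" "P I"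
  obtains m where "m \<epsilon> r" "P m" "\<And>J. J \<epsilon> r \<Longrightarrow> P J \<Longrightarrow> is_subset m J"
proof -
  let ?Q = "collect (\<lambda>I. I \<epsilon> r \<and> P I)"
  have Q: "I \<epsilon> ?Q \<longleftrightarrow> I \<epsilon> r \<and> P I" for I
    by (rule mem_collect_bounded[where a = r]) (blast | rule assms(2) definable definable_term_shift)+
  have "I \<epsilon> ?Q" using assms(3,4) Q by blast
  moreover have "is_subset ?Q r" by (rule subsetI) (use Q in blast)
  ultimately obtain m where "m \<epsilon> ?Q" "\<And>y. y \<epsilon> ?Q \<Longrightarrow> is_subset m y"
    using good_least[OF assms(1)] by blast
  then show thesis using that Q by blast
qed

lemma good_mem_union:
  assumes "good r" "a \<epsilon> union_of r"
  shows "is_subset a X"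
proof -
  obtain I where "I \<epsilon> r" "a \<epsilon> I" using assms(2) by auto
  then have "is_subset I (pow X)"
    using good_subset[OF assms(1)] by (simp add: is_subset_def)
  then show ?thesis using \<open>a \<epsilon> I\<close> by (simp add: is_subset_def)
qed

lemma good_stage:
  assumes "good r"
  shows "stage mem X cov r"
proof unfold_locales
  show "I \<epsilon> r \<Longrightarrow> J \<epsilon> r \<Longrightarrow> is_subset I J \<or> is_subset J I" for I J
    by (rule good_chain[OF assms])
  show "a \<epsilon> union_of r \<Longrightarrow> is_subset a X" for a
    by (rule good_mem_union[OF assms])
next
  fix q Q assume Q: "q \<epsilon> Q" "is_subset Q (union_of r)"
  then have "q \<epsilon> union_of r" by (simp add: is_subset_def)
  then obtain I0 where I0: "I0 \<epsilon> r" "q \<epsilon> I0" by auto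
  \<comment> \<open>Any element of \<open>Q\<close> in the least segment \<open>I\<close> meeting
    \<open>Q\<close> will do: a segment containing \<open>y\<close> but not \<open>m\<close> would
    also meet \<open>Q\<close>, hence include \<open>I\<close>.\<close>
  have "definable (\<lambda>v. \<exists>q. q \<epsilon> Q \<and> q \<epsilon> v 0)"
    by (rule definable definable_term_shift)+
  moreover have "\<exists>q. q \<epsilon> Q \<and> q \<epsilon> I0" using Q(1) I0(2) by blast
  ultimately obtain I where I: "I \<epsilon> r" "\<exists>q. q \<epsilon> Q \<and> q \<epsilon> I"
      "\<And>J. J \<epsilon> r \<Longrightarrow> \<exists>q. q \<epsilon> Q \<and> q \<epsilon> J \<Longrightarrow> is_subset I J"
    using good_least_with[OF assms _ I0(1), of "\<lambda>I. \<exists>q. q \<epsilon> Q \<and> q \<epsilon> I"] by blast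
  then obtain m where m: "m \<epsilon> Q" "m \<epsilon> I" by blast
  have "\<not> precedes r y m" if y: "y \<epsilon> Q" for y
  proof
    assume "precedes r y m"
    then obtain J where J: "J \<epsilon> r" "y \<epsilon> J" "\<not> m \<epsilon> J" unfolding precedes_def by blast
    then have "is_subset I J" using I(3)[OF J(1)] y by blast
    then show False using m(2) J(3) by (simp add: is_subset_def)
  qed
  then show "\<exists>m. m \<epsilon> Q \<and> (\<forall>y. y \<epsilon> Q \<longrightarrow> \<not> precedes r y m)" using m(1) by blast
next
  fix a b assume ab: "a \<epsilon> union_of r" "b \<epsilon> union_of r"
  show "a = b \<or> precedes r a b \<or> precedes r b a"
  proof (rule ccontr)
    assume "\<not> ?thesis"
    then have neq: "a \<noteq> b" and sep: "\<And>I. I \<epsilon> r \<Longrightarrow> a \<epsilon> I \<longleftrightarrow> b \<epsilon> I"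
      unfolding precedes_def by blast+
    obtain I0 where I0: "I0 \<epsilon> r" "a \<epsilon> I0" using ab(1) by auto
    have "definable (\<lambda>v. a \<epsilon> v 0)"
      by (rule definable definable_term_shift)+
    then obtain I where I: "I \<epsilon> r" "a \<epsilon> I" "\<And>J. J \<epsilon> r \<Longrightarrow> a \<epsilon> J \<Longrightarrow> is_subset I J"
      using good_least_with[OF assms _ I0(1), of "\<lambda>I. a \<epsilon> I"] I0(2) by blast
    have no: "\<not> a \<epsilon> J" if "J \<epsilon> initial r I" for J
      using that I(3)[of J] subset_antisym[of I J] unfolding mem_initial by blast
    have eq: "next_stage (initial r I) = I" by (rule good_next[OF assms I(1)])
    \<comment> \<open>An element of \<open>I\<close> in no earlier segment can only be the one
      adjoined last, so two members that no segment separates coincide.\<close>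
    have "c = diagonal (initial r I)" if c: "c \<epsilon> I" "\<And>J. J \<epsilon> initial r I \<Longrightarrow> \<not> c \<epsilon> J" for c
    proof -
      have "c \<epsilon> next_stage (initial r I)" using c(1) eq by simp
      then show ?thesis using c(2) by (auto simp: mem_next_stage)
    qed
    moreover have "\<not> b \<epsilon> J" if J: "J \<epsilon> initial r I" for J
      using no[OF J] sep[of J] J unfolding mem_initial by blast
    moreover have "b \<epsilon> I" using sep[OF I(1)] I(2) by blast
    ultimately have "a = b" using I(2) no by metis
    then show False using neq by blast
  qed
qed

lemma diagonal_not_in_union: "good r \<Longrightarrow> \<not> diagonal r \<epsilon> union_of r"
  by (rule stage.diagonal_new[OF good_stage])

section \<open>Comparability of approximations\<close>

definition initial_part :: "'u \<Rightarrow> 'u \<Rightarrow> bool" where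
  "initial_part r s \<longleftrightarrow> (\<forall>I. I \<epsilon> r \<longrightarrow> I \<epsilon> s \<and> initial r I = initial s I)"

definition common_part :: "'u \<Rightarrow> 'u \<Rightarrow> 'u" where
  "common_part r s = collect (\<lambda>I. I \<epsilon> r \<and> I \<epsilon> s \<and> initial r I = initial s I)"

lemma mem_common_part: "I \<epsilon> common_part r s \<longleftrightarrow> I \<epsilon> r \<and> I \<epsilon> s \<and> initial r I = initial s I"
  unfolding common_part_def
  by (rule mem_collect_bounded[where a = r]) (blast | rule definable definable_term_shift)+

lemma common_part_commute: "common_part r s = common_part s r"
  by (rule set_eqI) (auto simp: mem_common_part)

lemma initial_initial:
  assumes "I \<epsilon> initial r K"
  shows "initial (initial r K) I = initial r I"
proof (rule set_eqI)
  fix J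
  have K: "is_subset I K" "I \<noteq> K" using assms by (simp_all add: mem_initial)
  have "is_subset J K \<and> J \<noteq> K" if "is_subset J I"
    using that K subset_antisym[OF K(1)] by (auto simp: is_subset_def)
  then show "J \<epsilon> initial (initial r K) I \<longleftrightarrow> J \<epsilon> initial r I"
    unfolding mem_initial by blast
qed

text \<open>The common part is closed downwards in \<open>r\<close>, so exactly its elements lie
  below the least element outside it.\<close>

lemma least_outside_common_part:
  assumes "good r" "\<not> initial_part r s"
  shows "\<exists>I. I \<epsilon> r \<and> \<not> I \<epsilon> common_part r s \<and> initial r I = common_part r s"
proof -
  let ?K = "common_part r s"
  obtain I0 where I0: "I0 \<epsilon> r" "\<not> I0 \<epsilon> ?K"
    using assms(2) unfolding initial_part_def mem_common_part by blast
  have "definable (\<lambda>v. \<not> v 0 \<epsilon> ?K)"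
    by (rule definable definable_term_shift)+
  then obtain I where I: "I \<epsilon> r" "\<not> I \<epsilon> ?K" "\<And>J. J \<epsilon> r \<Longrightarrow> \<not> J \<epsilon> ?K \<Longrightarrow> is_subset I J"
    using good_least_with[OF assms(1) _ I0(1), of "\<lambda>I. \<not> I \<epsilon> ?K"] I0(2) by blast
  have "initial r I = ?K"
  proof (rule set_eqI)
    fix J
    show "J \<epsilon> initial r I \<longleftrightarrow> J \<epsilon> ?K"
    proof
      assume "J \<epsilon> initial r I"
      then have J: "J \<epsilon> r" "is_subset J I" "J \<noteq> I" by (simp_all add: mem_initial)
      show "J \<epsilon> ?K" using I(3)[OF J(1)] subset_antisym[OF J(2)] J(3) by blast
    next
      assume JK: "J \<epsilon> ?K"
      then have J: "J \<epsilon> r" "J \<epsilon> s" "initial r J = initial s J"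
        by (simp_all add: mem_common_part)
      have "J \<noteq> I" using JK I(2) by blast
      \<comment> \<open>Below \<open>J\<close> the two approximations coincide, so an
        \<open>I\<close> included in \<open>J\<close> would itself belong to the common
        part.\<close>
      have "\<not> is_subset I J"
      proof
        assume "is_subset I J"
        then have Ir: "I \<epsilon> initial r J" using I(1) \<open>J \<noteq> I\<close> by (simp add: mem_initial)
        then have Is: "I \<epsilon> initial s J" using J(3) by simp
        have "initial r I = initial s I"
          using initial_initial[OF Ir] initial_initial[OF Is] J(3) by simp
        moreover have "I \<epsilon> s" using Is by (simp add: mem_initial)
        ultimately show False using I(1,2) by (simp add: mem_common_part)
      qed
      then show "J \<epsilon> initial r I"
        using good_chain[OF assms(1) I(1) J(1)] J(1) \<open>J \<noteq> I\<close> by (simp add: mem_initial)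
    qed
  qed
  then show ?thesis using I(1,2) by blast
qed

text \<open>If both went on beyond the common part, both would go on with \<open>next_stage\<close>
  of it, and that segment would be common too.\<close>

lemma initial_part_linear:
  assumes "good r" "good s"
  shows "initial_part r s \<or> initial_part s r"
proof (rule ccontr)
  assume "\<not> ?thesis"
  then have n: "\<not> initial_part r s" "\<not> initial_part s r" by blast+
  obtain I where I: "I \<epsilon> r" "\<not> I \<epsilon> common_part r s" "initial r I = common_part r s"
    using least_outside_common_part[OF assms(1) n(1)] by blast
  obtain J where J: "J \<epsilon> s" "\<not> J \<epsilon> common_part s r" "initial s J = common_part s r"
    using least_outside_common_part[OF assms(2) n(2)] by blast
  have eq: "initial s J = initial r I" using I(3) J(3) common_part_commute by metis
  then have "J = I" using good_next[OF assms(1) I(1)] good_next[OF assms(2) J(1)] by simp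
  then show False using I J(1) eq by (simp add: mem_common_part)
qed

lemma initial_partD:
  assumes "initial_part r s" "I \<epsilon> r"
  shows "I \<epsilon> s" "initial r I = initial s I"
  using assms by (simp_all add: initial_part_def)

section \<open>The union of all approximations\<close>

definition limit_stage :: 'u where
  "limit_stage = collect (\<lambda>I. \<exists>r. good r \<and> I \<epsilon> r)"

lemma mem_limit_stage: "I \<epsilon> limit_stage \<longleftrightarrow> (\<exists>r. good r \<and> I \<epsilon> r)"
  unfolding limit_stage_def
proof (rule mem_collect_bounded[where a = "pow (pow X)"])
  show "I \<epsilon> pow (pow X)" if "\<exists>r. good r \<and> I \<epsilon> r" for I
    using that good_subset by (auto simp: is_subset_def)
qed (rule definable definable_term_shift)+

text \<open>Comparability prevents another approximation from inserting anything below a segment of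
  \<open>r\<close>.\<close>

lemma initial_limit_stage:
  assumes "good r" "I \<epsilon> r"
  shows "initial limit_stage I = initial r I"
proof (rule set_eqI)
  fix J
  have "J \<epsilon> r" if J: "good s" "J \<epsilon> s" "is_subset J I" "J \<noteq> I" for s
    using initial_part_linear[OF assms(1) J(1)]
  proof
    assume "initial_part r s"
    then have "J \<epsilon> initial r I"
      using initial_partD[of r s I] assms(2) J by (simp add: mem_initial)
    then show ?thesis by (simp add: mem_initial)
  qed (use initial_partD(1) J(2) in blast)
  then show "J \<epsilon> initial limit_stage I \<longleftrightarrow> J \<epsilon> initial r I"
    unfolding mem_initial mem_limit_stage using assms(1) by blast
qed

lemma good_limit_stage: "good limit_stage"
  unfolding good_def
proof (intro conjI allI impI; (elim conjE)?)
  show "is_subset limit_stage (pow (pow X))"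
  proof (rule subsetI)
    fix I assume "I \<epsilon> limit_stage"
    then obtain r where "good r" "I \<epsilon> r" unfolding mem_limit_stage by blast
    then show "I \<epsilon> pow (pow X)" using good_subset[of r] by (simp add: is_subset_def)
  qed
next
  fix I J assume "I \<epsilon> limit_stage" "J \<epsilon> limit_stage"
  then obtain r s where rs: "good r" "I \<epsilon> r" "good s" "J \<epsilon> s" unfolding mem_limit_stage by blast
  from initial_part_linear[OF rs(1,3)] show "is_subset I J \<or> is_subset J I"
  proof
    assume "initial_part r s"
    then show ?thesis using good_chain[OF rs(3)] initial_partD(1) rs(2,4) by blast
  next
    assume "initial_part s r"
    then show ?thesis using good_chain[OF rs(1)] initial_partD(1) rs(2,4) by blast
  qed
next
  fix I assume "I \<epsilon> limit_stage"
  then obtain r where r: "good r" "I \<epsilon> r" unfolding mem_limit_stage by blast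
  show "I = next_stage (initial limit_stage I)"
    using good_next[OF r] initial_limit_stage[OF r] by simp
next
  fix Q q assume Q: "q \<epsilon> Q" "is_subset Q limit_stage"
  then have "q \<epsilon> limit_stage" by (simp add: is_subset_def)
  then obtain r where r: "good r" "q \<epsilon> r" unfolding mem_limit_stage by blast
  have "definable (\<lambda>v. v 0 \<epsilon> Q)"
    by (rule definable definable_term_shift)+
  then obtain m where m: "m \<epsilon> r" "m \<epsilon> Q" "\<And>J. J \<epsilon> r \<Longrightarrow> J \<epsilon> Q \<Longrightarrow> is_subset m J"
    using good_least_with[OF r(1) _ r(2), of "\<lambda>I. I \<epsilon> Q"] Q(1) by blast
  \<comment> \<open>A \<open>y\<close> from another approximation that did not include
    \<open>m\<close> would come before \<open>m\<close> and hence lie in \<open>r\<close>, where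
    \<open>m\<close> is least.\<close>
  have "is_subset m y" if y: "y \<epsilon> Q" for y
  proof (rule ccontr)
    assume n: "\<not> is_subset m y"
    have "y \<epsilon> limit_stage" using y Q(2) by (simp add: is_subset_def)
    then obtain s where s: "good s" "y \<epsilon> s" unfolding mem_limit_stage by blast
    have "y \<epsilon> r"
      using initial_part_linear[OF r(1) s(1)]
    proof
      assume p: "initial_part r s"
      then have "m \<epsilon> s" using initial_partD(1) m(1) by blast
      then have "is_subset y m" using good_chain[OF s(1) _ s(2)] n by blast
      moreover have "y \<noteq> m" using n by (auto simp: is_subset_def)
      ultimately have "y \<epsilon> initial r m"
        using s(2) initial_partD(2)[OF p m(1)] by (simp add: mem_initial)
      then show ?thesis by (simp add: mem_initial)
    qed (use initial_partD(1) s(2) in blast)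
    then show False using m(3) y n by blast
  qed
  then show "\<exists>m. m \<epsilon> Q \<and> (\<forall>y. y \<epsilon> Q \<longrightarrow> is_subset m y)" using m(2) by blast
qed

text \<open>Since the diagonal set is new, the added segment properly includes all others: it comes
  last and leaves the predecessors of the old ones unchanged.\<close>

lemma good_extend:
  assumes "good r"
  shows "good (insert_in (next_stage r) r)"
proof -
  let ?N = "next_stage r" and ?r = "insert_in (next_stage r) r"
  have below: "is_subset I ?N" if "I \<epsilon> r" for I
    by (rule subsetI) (use that in \<open>auto simp: mem_next_stage\<close>)
  have "diagonal r \<epsilon> ?N" by (simp add: mem_next_stage)
  then have new: "\<not> is_subset ?N I" if "I \<epsilon> r" for I
    using diagonal_not_in_union[OF assms] that by (auto simp: is_subset_def)
  have N: "is_subset ?N ?N" by (simp add: is_subset_def)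
  show ?thesis
    unfolding good_def
  proof (intro conjI allI impI; (elim conjE)?)
    have "is_subset (diagonal r) X" by (rule subsetI) (simp add: mem_diagonal)
    then have "is_subset ?N (pow X)"
      using good_mem_union[OF assms] by (intro subsetI) (auto simp: mem_next_stage)
    then show "is_subset ?r (pow (pow X))"
      using good_subset[OF assms] by (simp add: is_subset_def)
  next
    fix I J assume "I \<epsilon> ?r" "J \<epsilon> ?r"
    then show "is_subset I J \<or> is_subset J I"
      using good_chain[OF assms, of I J] below N by auto
  next
    fix I assume "I \<epsilon> ?r"
    then consider "I = ?N" | "I \<epsilon> r" by auto
    then show "I = next_stage (initial ?r I)"
    proof cases
      case 1
      have "initial ?r I = r"
      proof (rule set_eqI)
        fix J show "J \<epsilon> initial ?r I \<longleftrightarrow> J \<epsilon> r"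
          using below[of J] new[of J] N 1 by (auto simp: mem_initial)
      qed
      then show ?thesis using 1 by simp
    next
      case 2
      have "initial ?r I = initial r I"
        by (rule set_eqI) (use new[OF 2] in \<open>auto simp: mem_initial\<close>)
      then show ?thesis using good_next[OF assms 2] by simp
    qed
  next
    fix Q q assume Q: "q \<epsilon> Q" "is_subset Q ?r"
    show "\<exists>m. m \<epsilon> Q \<and> (\<forall>y. y \<epsilon> Q \<longrightarrow> is_subset m y)"
    proof (cases "\<exists>I. I \<epsilon> r \<and> I \<epsilon> Q")
      case True
      then obtain I0 where I0: "I0 \<epsilon> r" "I0 \<epsilon> Q" by blast
      have "definable (\<lambda>v. v 0 \<epsilon> Q)"
        by (rule definable definable_term_shift)+
      then obtain m where m: "m \<epsilon> r" "m \<epsilon> Q" "\<And>J. J \<epsilon> r \<Longrightarrow> J \<epsilon> Q \<Longrightarrow> is_subset m J"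
        using good_least_with[OF assms _ I0(1), of "\<lambda>I. I \<epsilon> Q"] I0(2) by blast
      have "is_subset m y" if y: "y \<epsilon> Q" for y
      proof -
        have "y = ?N \<or> y \<epsilon> r" using y Q(2) by (simp add: is_subset_def)
        then show ?thesis using below[OF m(1)] m(3) y by blast
      qed
      then show ?thesis using m(2) by blast
    next
      case False
      then have "y = ?N" if "y \<epsilon> Q" for y
        using that Q(2) by (auto simp: is_subset_def)
      then show ?thesis using Q(1) N by metis
    qed
  qed
qed

text \<open>As in the Burali-Forti paradox, the union of all approximations would contain its own
  extension, hence its own diagonal set among its members.\<close>

theorem no_finite_cover: False
proof -
  have "next_stage limit_stage \<epsilon> limit_stage"
    unfolding mem_limit_stage
    using good_extend[OF good_limit_stage] by (intro exI conjI) auto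
  then have "diagonal limit_stage \<epsilon> union_of limit_stage"
    by (auto simp: mem_next_stage)
  then show False using diagonal_not_in_union[OF good_limit_stage] by blast
qed

end

section \<open>Finitary partitions\<close>

context ZF_model
begin

definition fill_up :: "'u \<Rightarrow> 'u \<Rightarrow> 'u" where
  "fill_up A S = collect (\<lambda>b. b \<epsilon> S \<or> (\<exists>a. a \<epsilon> A \<and> b = upair a a \<and> \<not> a \<epsilon> union_of S))"

lemma definable_fill_up [definable]:
  "definable_term f \<Longrightarrow> definable_term g \<Longrightarrow> definable_term (\<lambda>v. fill_up (f v) (g v))"
  unfolding fill_up_def by (assumption | rule definable definable_term_shift)+

lemma mem_fill_up:
  "b \<epsilon> fill_up A S \<longleftrightarrow> b \<epsilon> S \<or> (\<exists>a. a \<epsilon> A \<and> b = upair a a \<and> \<not> a \<epsilon> union_of S)"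
  unfolding fill_up_def
proof (rule mem_collect_bounded[where a = "union2 S (pow A)"])
  show "b \<epsilon> union2 S (pow A)"
    if "b \<epsilon> S \<or> (\<exists>a. a \<epsilon> A \<and> b = upair a a \<and> \<not> a \<epsilon> union_of S)" for b
    using that by (auto simp: is_subset_def)
qed (rule definable definable_term_shift)+

lemma fill_up_partition:
  assumes "is_finitary_partition P A" "is_subset S P"
  shows "is_finitary_partition (fill_up A S) A"
proof -
  have P: "\<And>b. b \<epsilon> P \<Longrightarrow> is_subset b A \<and> \<not> is_empty b \<and> is_finite b"
    "\<And>b c x. b \<epsilon> P \<Longrightarrow> c \<epsilon> P \<Longrightarrow> x \<epsilon> b \<Longrightarrow> x \<epsilon> c \<Longrightarrow> b = c"
    using assms(1) unfolding is_finitary_partition_def is_partition_def by blast+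
  have S: "b \<epsilon> P" if "b \<epsilon> S" for b
    using assms(2) that by (simp add: is_subset_def)
  have "insert_in a emp = upair a a" for a
    by (rule set_eqI) simp
  then have fin: "is_finite (upair a a)" for a
    using finite_insert[OF finite_emp, of a] by simp
  show ?thesis
    unfolding is_finitary_partition_def is_partition_def
  proof (intro conjI allI impI)
    fix b assume "b \<epsilon> fill_up A S"
    then consider "b \<epsilon> P" | a where "a \<epsilon> A" "b = upair a a"
      unfolding mem_fill_up using S by blast
    then have "is_subset b A \<and> \<not> is_empty b \<and> is_finite b"
    proof cases
      case (2 a)
      then show ?thesis using fin[of a] by (auto simp: is_subset_def is_empty_def)
    qed (rule P(1))
    then show "is_subset b A" "\<not> is_empty b" "is_finite b" by blast+
  next
    fix b c assume bc: "b \<epsilon> fill_up A S \<and> c \<epsilon> fill_up A S \<and> b \<noteq> c"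
    \<comment> \<open>Whether \<open>x\<close> lies in the union of \<open>S\<close> decides its
      block: a member of \<open>S\<close> if it does, its singleton if not.\<close>
    have block: "b \<epsilon> S \<or> b = upair x x \<and> \<not> x \<epsilon> union_of S" if "b \<epsilon> fill_up A S" "x \<epsilon> b" for b x
      using that unfolding mem_fill_up by auto
    have "b = c" if x: "x \<epsilon> b" "x \<epsilon> c" for x
    proof (cases "x \<epsilon> union_of S")
      case True
      then have "b \<epsilon> S" "c \<epsilon> S" using block bc x by blast+
      then show ?thesis using P(2)[OF S S x] by blast
    next
      case False
      then have "\<not> b \<epsilon> S" "\<not> c \<epsilon> S" using x by auto
      then show ?thesis using block[of b x] block[of c x] bc x by simp
    qed
    then show "\<not> (\<exists>x. x \<epsilon> b \<and> x \<epsilon> c)" using bc by blast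
  next
    fix x assume x: "x \<epsilon> A"
    show "\<exists>b. b \<epsilon> fill_up A S \<and> x \<epsilon> b"
    proof (cases "x \<epsilon> union_of S")
      case True
      then show ?thesis unfolding mem_fill_up by auto
    next
      case False
      then have "upair x x \<epsilon> fill_up A S" using x unfolding mem_fill_up by blast
      then show ?thesis by (intro exI[of _ "upair x x"]) simp
    qed
  qed
qed

text \<open>\<open>S\<close> is recovered as the set of blocks that are not singletons; this is
  where singleton blocks in \<open>P\<close> would do harm.\<close>

lemma fill_up_inject:
  assumes "\<forall>b. b \<epsilon> P \<longrightarrow> \<not> is_singleton b" "is_subset S P" "is_subset T P"
    and "fill_up A S = fill_up A T"
  shows "S = T"
proof -
  have sub: "is_subset S T" if "is_subset S P" "fill_up A S = fill_up A T" for S T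
  proof (rule subsetI)
    fix b assume b: "b \<epsilon> S"
    then have "b \<epsilon> P" using that(1) by (simp add: is_subset_def)
    then have "b \<noteq> upair a a" for a
      using assms(1) unfolding is_singleton_def is_upair_iff by blast
    moreover have "b \<epsilon> fill_up A T"
      using b that(2) mem_fill_up[of b A S] by simp
    ultimately show "b \<epsilon> T" using mem_fill_up[of b A T] by blast
  qed
  show ?thesis
    by (rule subset_antisym[OF sub[OF assms(2,4)] sub[OF assms(3) assms(4)[symmetric]]])
qed

lemma finitary_partitions_exist: "\<exists>B. is_finitary_partitions B A"
proof
  let ?B = "collect (\<lambda>Q. is_finitary_partition Q A)"
  have "Q \<epsilon> ?B \<longleftrightarrow> is_finitary_partition Q A" for Q
  proof (rule mem_collect_bounded[where a = "pow (pow A)"])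
    show "Q \<epsilon> pow (pow A)" if "is_finitary_partition Q A" for Q
    proof -
      have "b \<epsilon> Q \<Longrightarrow> is_subset b A" for b
        using that unfolding is_finitary_partition_def is_partition_def by blast
      then show ?thesis by (simp add: is_subset_def)
    qed
  qed (rule definable definable_term_shift)+
  then show "is_finitary_partitions ?B A"
    unfolding is_finitary_partitions_def by blast
qed

theorem no_surjection_onto_finitary_partitions:
  assumes A: "\<not> is_finite A" and P: "is_finitary_partition P A"
    and ns: "\<forall>b. b \<epsilon> P \<longrightarrow> \<not> is_singleton b"
    and B: "is_finitary_partitions B A" and f: "is_surjection f A B"
  shows False
proof -
  have blocks: "b \<epsilon> P \<Longrightarrow> a \<epsilon> b \<Longrightarrow> a \<epsilon> A" "b \<epsilon> P \<Longrightarrow> is_finite b"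
    "a \<epsilon> A \<Longrightarrow> \<exists>b. b \<epsilon> P \<and> a \<epsilon> b" for a b
  proof -
    have *: "b \<epsilon> P \<Longrightarrow> is_subset b A" "b \<epsilon> P \<Longrightarrow> is_finite b"
      "a \<epsilon> A \<Longrightarrow> \<exists>b. b \<epsilon> P \<and> a \<epsilon> b" for a b
      using P unfolding is_finitary_partition_def is_partition_def by blast+
    show "b \<epsilon> P \<Longrightarrow> a \<epsilon> b \<Longrightarrow> a \<epsilon> A" "b \<epsilon> P \<Longrightarrow> is_finite b"
      "a \<epsilon> A \<Longrightarrow> \<exists>b. b \<epsilon> P \<and> a \<epsilon> b"
      using *(1)[of b] *(2,3) by (simp_all add: is_subset_def)
  qed
  have unique: "y = z" if "a \<epsilon> A" "maps_to f a y" "maps_to f a z" for a y z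
    using f that unfolding is_surjection_def is_function_def by blast
  \<comment> \<open>The diagonal argument needs the index set and the base set to be the same.
    Elements of \<open>A\<close> would index subsets of \<open>P\<close>; grouping them into blocks
    makes \<open>P\<close> the index set, at the price of finitely many values per index.\<close>
  define cov where "cov x S \<longleftrightarrow>
    x \<epsilon> P \<and> is_subset S P \<and> (\<exists>a. a \<epsilon> x \<and> maps_to f a (fill_up A S))" for x S
  have "finite_cover mem P cov"
  proof unfold_locales
    show "definable (\<lambda>v. cov (v 0) (v 1))"
      unfolding cov_def by (rule definable_term_var1 definable definable_term_shift)+
    show "cov x S \<Longrightarrow> is_subset S P" for x S
      by (simp add: cov_def)
  next
    fix x assume x: "x \<epsilon> P"
    define R where "R a S \<longleftrightarrow> is_subset S P \<and> maps_to f a (fill_up A S)" for a S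
    have "definable (\<lambda>v. R (v 0) (v 1))"
      unfolding R_def by (rule definable_term_var1 definable definable_term_shift)+
    with blocks(2)[OF x] have "\<exists>t. is_finite t \<and> (\<forall>a S. a \<epsilon> x \<and> R a S \<longrightarrow> S \<epsilon> t)"
    proof (rule finite_UN)
      fix a assume "a \<epsilon> x"
      then have a: "a \<epsilon> A" using blocks(1)[OF x] by blast
      show "\<exists>t. is_finite t \<and> (\<forall>S. R a S \<longrightarrow> S \<epsilon> t)"
      proof (cases "\<exists>S. R a S")
        case True
        then obtain S where S: "R a S" ..
        \<comment> \<open>An element of a block has one image under \<open>f\<close>, and by
          injectivity of \<open>fill_up\<close> it accounts for at most one subset of
          \<open>P\<close>.\<close>
        have "T = S" if "R a T" for T
        proof (rule fill_up_inject[OF ns])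
          show "is_subset T P" "is_subset S P" using S that by (simp_all add: R_def)
          show "fill_up A T = fill_up A S"
            by (rule unique[OF a]) (use S that in \<open>simp_all add: R_def\<close>)
        qed
        then have "\<forall>T. R a T \<longrightarrow> T \<epsilon> insert_in S emp" by simp
        then show ?thesis
          using finite_insert[OF finite_emp, of S] by blast
      qed (use finite_emp in blast)
    qed
    then show "\<exists>t. is_finite t \<and> (\<forall>S. cov x S \<longrightarrow> S \<epsilon> t)"
      unfolding cov_def R_def by blast
  next
    fix S assume S: "is_subset S P"
    then have "fill_up A S \<epsilon> B"
      using B fill_up_partition[OF P] unfolding is_finitary_partitions_def by blast
    then obtain a where a: "a \<epsilon> A" "maps_to f a (fill_up A S)"
      using f unfolding is_surjection_def by blast
    obtain x where "x \<epsilon> P" "a \<epsilon> x" using blocks(3)[OF a(1)] by blast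
    then show "\<exists>x. x \<epsilon> P \<and> cov x S"
      using S a(2) unfolding cov_def by blast
  next
    \<comment> \<open>Otherwise \<open>A\<close> would be a finite union of finite blocks.\<close>
    show "\<not> is_finite P"
    proof
      assume "is_finite P"
      moreover have "definable (\<lambda>v. v 1 \<epsilon> v 0)"
        by (rule definable_term_var1 definable definable_term_shift)+
      ultimately have "\<exists>t. is_finite t \<and> (\<forall>b a. b \<epsilon> P \<and> a \<epsilon> b \<longrightarrow> a \<epsilon> t)"
        by (rule finite_UN) (use blocks(2) in blast)
      then obtain t where t: "is_finite t" "\<And>b a. b \<epsilon> P \<Longrightarrow> a \<epsilon> b \<Longrightarrow> a \<epsilon> t" by blast
      have "is_subset A t"
        by (rule subsetI) (use blocks(3) t(2) in blast)
      then show False using finite_subset_in[OF t(1)] A by blast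
    qed
  qed
  then show False by (rule finite_cover.no_finite_cover)
qed

end

theorem theorem4p21:
  fixes mem :: "'u \<Rightarrow> 'u \<Rightarrow> bool" and A :: 'u
  assumes "ZF_model mem"
    and "set_structure.is_infinite mem A"
    and "\<exists>P. set_structure.is_finitary_partition mem P A \<and>
             (\<forall>b. mem b P \<longrightarrow> \<not> set_structure.is_singleton mem b)"
  shows "\<exists>B. set_structure.is_finitary_partitions mem B A \<and>
             \<not> (\<exists>f. set_structure.is_surjection mem f A B)"
proof -
  interpret ZF_model mem by (rule assms(1))
  obtain P where P: "is_finitary_partition P A" "\<forall>b. mem b P \<longrightarrow> \<not> is_singleton b"
    using assms(3) by blast
  obtain B where B: "is_finitary_partitions B A"
    using finitary_partitions_exist ..
  have "\<not> is_surjection f A B" for f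
    using no_surjection_onto_finitary_partitions[OF _ P B, of f] assms(2)
    unfolding is_infinite_def by blast
  then show ?thesis using B by blast
qed

end
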